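(* Let $n\in\mathbb{N}$, $M\in\operatorname{GL}_n(\mathbb{R})$, let $S\subset S^{n-1}$ be a spherical cap, and let $\lambda$ be the Haar probability measure on $S^1$. Let $\mu$ be a probability measure on $S^1$ which is either absolutely continuous with respect to $\lambda$ or supported on one irrational point of $S^1$ (a point of the form $e^{2\pi i\alpha}$ with $\alpha\in\mathbb{R}\setminus\mathbb{Q}$). Then for any smooth $f:S\cdot\mathbb{R}_+\to\mathbb{R}$ which is $M$-$S$-related to $\mu$ and for any $u\in\mathbb{R}^n$, $f(M\mathbb{Z}^n+u)\bmod 1$ is equidistributed.
   Context: $\mathbb{N}=\{1,2,\dots\}$, $\mathbb{R}_+=(0,\infty)$, $S^{n-1}$ is the Euclidean unit sphere in $\mathbb{R}^n$, and $S\cdot\mathbb{R}_+=\{ta:t\in\mathbb{R}_+,\ a\in S\}$. A spherical cap is a subset of $S^{n-1}$ bounded by the intersection of a hyperplane with the sphere, i.e. a set $\{x\in S^{n-1}:\langle x,w\rangle>c\}$ or $\{x\in S^{n-1}:\langle x,w\rangle\ge c\}$ with $w\in S^{n-1}$ and $-1<c<1$; the whole sphere $S=S^{n-1}$ is also allowed. A function on $S\cdot\mathbb{R}_+$ is smooth if it is the restriction of a $C^\infty$ function defined on an open set containing $S\cdot\mathbb{R}_+$. For $v\in\mathbb{R}^n$ and $d\in\mathbb{N}$, the $d$-th derivative of $f$ in direction $v$ is $\frac{\partial^d f}{\partial v^d}(x)=\frac{d^d}{dt^d}\big|_{t=0}f(x+tv)$ ($v$ is not normalized). For a real function $g$, $g\bmod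 1$ is its composition with $\mathbb{R}\to\mathbb{R}/\mathbb{Z}$, and $\mathbb{R}/\mathbb{Z}$ is identified with the unit circle $S^1$ via $t\mapsto e^{2\pi i t}$; $\phi_*$ denotes push-forward of measures. Let $m_S$ be the restriction to $S$ of the rotation-invariant probability measure on $S^{n-1}$, normalized to be a probability measure. A smooth function $f:S\cdot\mathbb{R}_+\to\mathbb{R}$ is $M$-$S$-related to a probability measure $\mu$ on $S^1$ if there exist $d\in\mathbb{N}$ and $v\in M\mathbb{Z}^n$ such that: (i) $\frac{\partial^d f}{\partial v^d}$ is degree-$0$-homogeneous, i.e. invariant under multiplication of the argument by positive scalars; (ii) $\left(\frac{\partial^d f}{\partial v^d}\bmod 1\right)_*m_S=\mu$, the derivative being regarded as a function on $S$; and (iii) $\frac{\partial^{d+1}f}{\partial v^{d+1}}(x)\to 0$ as $\|x\|_2\to\infty$ (with $x\in S\cdot\mathbb{R}_+$). Equidistribution: let $\Gamma\subset\mathbb{R}^n$ be a discrete set and $F:D\to\mathbb{R}$ with $D\subset\mathbb{R}^n$. Let $B_R(0)$ be the Euclidean ball of radius $R$ around the origin, and let $\sigma_R^D$ be the normalized counting measure (uniform probability measure) on the finite set $\Gamma\cap B_R(0)\cap D$, defined for all $R$ large enough that this set is nonempty. One says that $F(\Gamma)\bmod 1$ is equidistributed if $(F\bmod 1)_*\sigma_R^D$ converges weakly to $\lambda$ as $R\to\infty$. In this statement $D=S\cdot\mathbb{R}_+$ (so $f$ is evaluated only at points of $M\mathbb{Z}^n+u$ lying in $S\cdot\mathbb{R}_+$)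 and $\Gamma=M\mathbb{Z}^n+u$. *)

theory Defs
  imports "HOL-Probability.Probability"
begin

section \<open>Invariant probability measures on unit spheres\<close>

definition sphere_borel :: "'a::euclidean_space measure" where
  "sphere_borel = restrict_space borel (sphere 0 1)"

definition invariant_prob :: "('a::euclidean_space \<Rightarrow> 'a) set \<Rightarrow> 'a measure \<Rightarrow> bool" where
  "invariant_prob G m \<longleftrightarrow> prob_space m \<and> sets m = sets sphere_borel \<and>
     (\<forall>T\<in>G. distr m sphere_borel T = m)"

text \<open>Rotation invariance means invariance under the full orthogonal group. For \<open>n \<ge> 2\<close> invariance
  under \<open>SO(n)\<close> determines the same measure; for \<open>n = 1\<close> the reflection is needed for uniqueness.
  Existence and uniqueness are proved below, in \<open>invariant_prob_sphere_prob\<close> and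
  \<open>invariant_prob_orthogonal_unique\<close>, and likewise for the Haar measure.\<close>

definition sphere_prob :: "(real^'n) measure" where
  "sphere_prob = (THE m. invariant_prob {T. orthogonal_transformation T} m)"

definition haar_circle :: "complex measure" where
  "haar_circle = (THE m. invariant_prob ((\<lambda>z w. z * w) ` sphere 0 1) m)"

section \<open>Spherical caps and cones\<close>

definition spherical_cap :: "(real^'n) set \<Rightarrow> bool" where
  "spherical_cap S \<longleftrightarrow> S = sphere 0 1 \<or>
     (\<exists>w c. norm w = 1 \<and> -1 < c \<and> c < 1 \<and>
        (S = {x \<in> sphere 0 1. x \<bullet> w > c} \<or> S = {x \<in> sphere 0 1. x \<bullet> w \<ge> c}))"

definition cone_over :: "(real^'n) set \<Rightarrow> (real^'n) set" where
  "cone_over S = {t *\<^sub>R a | t a. t > 0 \<and> a \<in> S}"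

definition cap_prob :: "(real^'n) set \<Rightarrow> (real^'n) measure" where
  "cap_prob S = uniform_measure (restrict_space sphere_prob S) S"

section \<open>Smooth functions on cones and their directional derivatives\<close>

primrec k_smooth_on :: "nat \<Rightarrow> (real^'n) set \<Rightarrow> (real^'n \<Rightarrow> real) \<Rightarrow> bool" where
  "k_smooth_on 0 U f \<longleftrightarrow> continuous_on U f"
| "k_smooth_on (Suc k) U f \<longleftrightarrow> (\<forall>x\<in>U. f differentiable (at x)) \<and>
     (\<forall>v. k_smooth_on k U (\<lambda>x. frechet_derivative f (at x) v))"

definition smooth_extension :: "(real^'n) set \<Rightarrow> (real^'n \<Rightarrow> real) \<Rightarrow> (real^'n \<Rightarrow> real) \<Rightarrow> bool" where
  "smooth_extension S f g \<longleftrightarrow>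
     (\<exists>U. open U \<and> cone_over S \<subseteq> U \<and> (\<forall>k. k_smooth_on k U g) \<and> (\<forall>x\<in>cone_over S. g x = f x))"

definition smooth_on_cone :: "(real^'n) set \<Rightarrow> (real^'n \<Rightarrow> real) \<Rightarrow> bool" where
  "smooth_on_cone S f \<longleftrightarrow> (\<exists>g. smooth_extension S f g)"

definition dir_deriv :: "nat \<Rightarrow> real^'n \<Rightarrow> (real^'n \<Rightarrow> real) \<Rightarrow> real^'n \<Rightarrow> real" where
  "dir_deriv d v g x = (deriv ^^ d) (\<lambda>t. g (x + t *\<^sub>R v)) 0"

text \<open>Only the values of \<open>f\<close> on the cone are meaningful, and the cone over a closed cap is not open, so
  derivatives of \<open>f\<close> are those of a smooth extension. On the cone they do not depend on the choice:
  the cone over a spherical cap lies in the closure of its interior.\<close>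

definition cone_deriv :: "(real^'n) set \<Rightarrow> nat \<Rightarrow> real^'n \<Rightarrow> (real^'n \<Rightarrow> real) \<Rightarrow> real^'n \<Rightarrow> real" where
  "cone_deriv S d v f = dir_deriv d v (SOME g. smooth_extension S f g)"

section \<open>Related functions and equidistribution\<close>

text \<open>Reduction modulo 1, with \<open>\<real>/\<int>\<close> identified with the unit circle.\<close>

definition mod1 :: "real \<Rightarrow> complex" where
  "mod1 t = cis (2 * pi * t)"

definition point_lattice :: "real^'n^'n \<Rightarrow> (real^'n) set" where
  "point_lattice M = {M *v z | z. \<forall>i. z $ i \<in> \<int>}"

definition MS_related :: "real^'n^'n \<Rightarrow> (real^'n) set \<Rightarrow> (real^'n \<Rightarrow> real) \<Rightarrow> complex measure \<Rightarrow> bool" where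
  "MS_related M S f \<mu> \<longleftrightarrow> (\<exists>d\<ge>1. \<exists>v\<in>point_lattice M.
     (\<forall>x\<in>cone_over S. \<forall>s>0. cone_deriv S d v f (s *\<^sub>R x) = cone_deriv S d v f x) \<and>
     distr (cap_prob S) sphere_borel (\<lambda>x. mod1 (cone_deriv S d v f x)) = \<mu> \<and>
     (cone_deriv S (d + 1) v f \<longlongrightarrow> 0) (inf at_infinity (principal (cone_over S))))"

definition weak_conv_on :: "'a::topological_space set \<Rightarrow> ('b \<Rightarrow> 'a measure) \<Rightarrow> 'a measure \<Rightarrow> 'b filter \<Rightarrow> bool" where
  "weak_conv_on X N m F \<longleftrightarrow> (\<forall>\<phi>::'a \<Rightarrow> real. continuous_on X \<phi> \<and> bounded (\<phi> ` X) \<longrightarrow>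
     ((\<lambda>r. integral\<^sup>L (N r) \<phi>) \<longlongrightarrow> integral\<^sup>L m \<phi>) F)"

definition equidistributed_mod1 :: "(real^'n) set \<Rightarrow> (real^'n) set \<Rightarrow> (real^'n \<Rightarrow> real) \<Rightarrow> bool" where
  "equidistributed_mod1 \<Gamma> D F \<longleftrightarrow>
     weak_conv_on (sphere 0 1)
       (\<lambda>R::real. distr (uniform_count_measure (\<Gamma> \<inter> ball 0 R \<inter> D)) sphere_borel (\<lambda>x. mod1 (F x)))
       haar_circle at_top"

section \<open>Existence and uniqueness of the invariant measures\<close>

lemma space_sphere_borel [simp]: "space sphere_borel = sphere 0 1"
  by (simp add: sphere_borel_def space_restrict_space)

lemma sphere_in_sphere_borel: "f \<in> borel_measurable borel \<Longrightarrow> f \<in> borel_measurable sphere_borel"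
  unfolding sphere_borel_def by (rule measurable_restrict_space1)

lemma orthogonal_borel: 
  assumes "orthogonal_transformation (T::'a::euclidean_space \<Rightarrow> 'a)" 
  shows "T \<in> borel_measurable borel"
  by (rule borel_measurable_continuous_onI)
    (metis assms orthogonal_transformation linear_continuous_on linear_conv_bounded_linear)

lemma orthogonal_sphere_borel: 
  assumes "orthogonal_transformation (T::'a::euclidean_space \<Rightarrow> 'a)" 
  shows "T \<in> measurable sphere_borel sphere_borel"
  unfolding sphere_borel_def
  by (rule measurable_restrict_space3)
    (use orthogonal_borel[OF assms] assms in \<open>auto simp: orthogonal_transformation_norm\<close>)

lemma nn_integral_lborel_translate:
  fixes c :: "'a::euclidean_space"
  assumes [measurable]: "f \<in> borel_measurable borel"
  shows "(\<integral>\<^sup>+x. f (c + x) \<partial>lborel) = (\<integral>\<^sup>+x. f x \<partial>lborel)"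
proof -
  have "(\<integral>\<^sup>+x. f x \<partial>distr lborel borel ((+) c)) = (\<integral>\<^sup>+x. f (c + x) \<partial>lborel)"
    by (rule nn_integral_distr) measurable
  then show ?thesis unfolding lborel_distr_plus by (rule sym)
qed

lemma lborel_distr_orthogonal:
  fixes T :: "'a::euclidean_space \<Rightarrow> 'a"
  assumes T: "orthogonal_transformation T"
  shows "distr lborel borel T = lborel"
proof (rule measure_eqI)
  fix A assume "A \<in> sets (distr lborel borel T)"
  then have A[measurable]: "A \<in> sets borel" by simp
  have T'[measurable]: "T \<in> borel_measurable borel" using T by (rule orthogonal_borel)
  have lin: "linear T" using T by (simp add: orthogonal_transformation)
  define B :: "'a set" where "B = ball 0 1"
  have B[measurable]: "B \<in> sets borel" by (simp add: B_def)
  have B_T: "indicator B (- T x) = (indicator B x :: ennreal)" for x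
    using T by (simp add: B_def indicator_def orthogonal_transformation_norm)
  have Tinv: "T (inv T y) = y" for y
    using T by (simp add: orthogonal_transformation_surj surj_f_inv_f)
  let ?L = "emeasure (lborel::'a measure)"
  have "?L (T -` A) * ?L B = (\<integral>\<^sup>+x. indicator A (T x) * ?L B \<partial>lborel)"
  proof -
    have "(\<integral>\<^sup>+x. indicator A (T x) * ?L B \<partial>lborel) = (\<integral>\<^sup>+x. indicator (T -` A) x * ?L B \<partial>lborel)"
      by (rule nn_integral_cong) (auto simp: indicator_def)
    also have "\<dots> = (\<integral>\<^sup>+x. indicator (T -` A) x \<partial>lborel) * ?L B"
      using measurable_sets[OF T' A] by (intro nn_integral_multc) auto
    finally show ?thesis using measurable_sets[OF T' A] by simp
  qed
  also have "\<dots> = (\<integral>\<^sup>+x. (\<integral>\<^sup>+y. indicator A (T x) * indicator B (y - T x) \<partial>lborel) \<partial>lborel)"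
  proof (rule nn_integral_cong)
    fix x
    have "(\<integral>\<^sup>+y. indicator A (T x) * indicator B (y - T x) \<partial>lborel) 
      = indicator A (T x) * (\<integral>\<^sup>+y. indicator B (- T x + y) \<partial>lborel)"
      by (subst nn_integral_cmult[symmetric]) (auto simp: algebra_simps)
    also have "\<dots> = indicator A (T x) * ?L B"
      by (subst nn_integral_lborel_translate) auto
    finally show "indicator A (T x) * ?L B = (\<integral>\<^sup>+y. indicator A (T x) * indicator B (y - T x) \<partial>lborel)"
      by simp
  qed
  also have "\<dots> = (\<integral>\<^sup>+y. (\<integral>\<^sup>+x. indicator A (T x) * indicator B (y - T x) \<partial>lborel) \<partial>lborel)"
    by (rule lborel_pair.Fubini'[symmetric]) measurable
  also have "\<dots> = (\<integral>\<^sup>+y. (\<integral>\<^sup>+x. indicator A (y + T x) * indicator B x \<partial>lborel) \<partial>lborel)"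
  proof (rule nn_integral_cong)
    fix y
    have "(\<integral>\<^sup>+x. indicator A (T x) * indicator B (y - T x) \<partial>lborel) =
      (\<integral>\<^sup>+x. indicator A (T (inv T y + x)) * indicator B (y - T (inv T y + x)) \<partial>lborel)"
      by (rule nn_integral_lborel_translate[symmetric]) measurable
    also have "\<dots> = (\<integral>\<^sup>+x. indicator A (y + T x) * indicator B x \<partial>lborel)"
      by (simp add: linear_add[OF lin] Tinv B_T)
    finally show "(\<integral>\<^sup>+x. indicator A (T x) * indicator B (y - T x) \<partial>lborel) =
      (\<integral>\<^sup>+x. indicator A (y + T x) * indicator B x \<partial>lborel)" .
  qed
  also have "\<dots> = (\<integral>\<^sup>+x. (\<integral>\<^sup>+y. indicator A (y + T x) * indicator B x \<partial>lborel) \<partial>lborel)"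
    by (rule lborel_pair.Fubini') measurable
  also have "\<dots> = (\<integral>\<^sup>+x. ?L A * indicator B x \<partial>lborel)"
  proof (rule nn_integral_cong)
    fix x
    have "(\<integral>\<^sup>+y. indicator A (y + T x) * indicator B x \<partial>lborel) 
      = (\<integral>\<^sup>+y. indicator A (T x + y) \<partial>lborel) * indicator B x"
      by (subst nn_integral_multc[symmetric]) (auto simp: add.commute)
    also have "\<dots> = ?L A * indicator B x"
      by (subst nn_integral_lborel_translate) auto
    finally show "(\<integral>\<^sup>+y. indicator A (y + T x) * indicator B x \<partial>lborel) = ?L A * indicator B x" .
  qed
  also have "\<dots> = ?L A * ?L B"
    by (rule nn_integral_cmult_indicator) simp
  finally have eq: "?L (T -` A) * ?L B = ?L A * ?L B" .
  have "?L B \<noteq> \<infinity>"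
    unfolding B_def using emeasure_lborel_ball_finite[of "0::'a" 1] by simp
  moreover have "?L B \<noteq> 0"
    unfolding B_def using open_not_negligible[of "ball (0::'a) 1"]
    by (auto simp: negligible_iff_null_sets null_sets_def)
  ultimately have "?L (T -` A) = ?L A"
    using eq by (metis ennreal_mult_cancel_left mult.commute infinity_ennreal_def)
  then show "emeasure (distr lborel borel T) A = ?L A"
    by (simp add: emeasure_distr)
qed simp

lemma uniform_ball_distr_orthogonal:
  fixes T :: "'a::euclidean_space \<Rightarrow> 'a"
  assumes T: "orthogonal_transformation T"
  shows "distr (uniform_measure lborel (ball 0 1)) borel T = uniform_measure lborel (ball 0 1)"
proof (rule measure_eqI)
  fix A assume "A \<in> sets (distr (uniform_measure lborel (ball 0 1)) borel T)"
  then have A[measurable]: "A \<in> sets borel" by simp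
  have T'[measurable]: "T \<in> borel_measurable borel" using T by (rule orthogonal_borel)
  have TA[measurable]: "T -` A \<in> sets borel" using measurable_sets[OF T' A] by simp
  have "ball 0 1 \<inter> T -` A = T -` (ball 0 1 \<inter> A)"
    using T by (auto simp: orthogonal_transformation_norm)
  then have "emeasure lborel (ball 0 1 \<inter> T -` A) = emeasure (distr lborel borel T) (ball 0 1 \<inter> A)"
    by (simp add: emeasure_distr)
  then show "emeasure (distr (uniform_measure lborel (ball 0 1)) borel T) A = 
      emeasure (uniform_measure lborel (ball 0 1)) A"
    by (simp add: emeasure_distr lborel_distr_orthogonal[OF T])
qed simp

lemma ex_invariant_prob_orthogonal:
  "\<exists>m::'a::euclidean_space measure. invariant_prob {T. orthogonal_transformation T} m"
proof -
  define U where "U = uniform_measure lborel (ball (0::'a) 1)"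
  obtain e :: 'a where e: "norm e = 1" using vector_choose_size[of 1] by auto
  define p where "p = (\<lambda>x::'a. if x = 0 then e else x /\<^sub>R norm x)"
  have [measurable_cong]: "sets U = sets borel" by (simp add: U_def)
  have p: "p \<in> measurable borel sphere_borel"
    unfolding sphere_borel_def 
    by (rule measurable_restrict_space2) (auto simp: p_def e)
  have pU: "p \<in> measurable U sphere_borel"
    using p by (simp add: U_def)
  interpret U: prob_space U
    unfolding U_def
  proof (rule prob_space_uniform_measure)
    show "emeasure lborel (ball (0::'a) 1) \<noteq> 0"
      using open_not_negligible[of "ball (0::'a) 1"]
      by (auto simp: negligible_iff_null_sets null_sets_def)
    show "emeasure lborel (ball (0::'a) 1) \<noteq> \<infinity>"
      using emeasure_lborel_ball_finite[of "0::'a" 1] by simp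
  qed
  have "distr (distr U sphere_borel p) sphere_borel T = distr U sphere_borel p"
    if T: "orthogonal_transformation T" for T
  proof -
    have lin: "linear T" using T by (simp add: orthogonal_transformation)
    note T'[measurable] = orthogonal_borel[OF T]
    note Ts = orthogonal_sphere_borel[OF T]
    have ae: "AE x in U. x \<noteq> 0"
      unfolding U_def
      by (rule AE_uniform_measureI) (use AE_lborel_singleton[of "0::'a"] in auto)
    have "distr (distr U sphere_borel p) sphere_borel T = distr U sphere_borel (T \<circ> p)"
      by (rule distr_distr[OF Ts pU])
    also have "\<dots> = distr U sphere_borel (p \<circ> T)"
    proof (rule distr_cong_AE)
      show "AE x in U. (T \<circ> p) x = (p \<circ> T) x"
        using ae
      proof eventually_elim
        case (elim x)
        then have "norm (T x) \<noteq> 0" using T by (simp add: orthogonal_transformation_norm)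
        then have "T x \<noteq> 0" by auto
        with elim show ?case
          using T by (simp add: p_def linear_scale[OF lin] orthogonal_transformation_norm)
      qed
      show "T \<circ> p \<in> measurable U sphere_borel" using pU Ts by (rule measurable_comp)
      show "p \<circ> T \<in> measurable U sphere_borel" 
        by (rule measurable_comp[OF _ p]) measurable
    qed auto
    also have "\<dots> = distr (distr U borel T) sphere_borel p"
      by (rule distr_distr[symmetric]) (use p in measurable)
    also have "distr U borel T = U"
      unfolding U_def by (rule uniform_ball_distr_orthogonal[OF T])
    finally show ?thesis .
  qed
  moreover have "prob_space (distr U sphere_borel p)"
    using pU by (rule U.prob_space_distr)
  ultimately show ?thesis
    unfolding invariant_prob_def by (intro exI[of _ "distr U sphere_borel p"]) auto
qed

lemma borel_measurable_sphere_prob: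
  assumes "sets m = sets sphere_borel" "f \<in> borel_measurable borel"
  shows "f \<in> borel_measurable m"
  using sphere_in_sphere_borel[OF assms(2)] assms(1) by (simp cong: measurable_cong_sets)

lemma integrable_sphere_continuous:
  fixes \<phi> :: "'a::euclidean_space \<Rightarrow> real"
  assumes "prob_space m" "sets m = sets sphere_borel" "continuous_on UNIV \<phi>"
  shows "integrable m \<phi>"
proof -
  interpret prob_space m by fact
  have sp: "space m = sphere 0 1" using sets_eq_imp_space_eq[OF assms(2)] by simp
  have "compact (\<phi> ` sphere 0 1)"
    using assms(3) by (intro compact_continuous_image) (auto intro: continuous_on_subset)
  then obtain B where B: "\<And>x. x \<in> sphere 0 1 \<Longrightarrow> norm (\<phi> x) \<le> B"
    by (meson bounded_iff compact_imp_bounded imageI)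
  show ?thesis
    using B sp 
    by (intro integrable_const_bound[of _ B] borel_measurable_sphere_prob[OF assms(2)] 
        borel_measurable_continuous_onI[OF assms(3)]) auto
qed

lemma sphere_measure_eqI:
  fixes m1 m2 :: "'a::euclidean_space measure"
  assumes p: "prob_space m1" "prob_space m2"
    and s: "sets m1 = sets sphere_borel" "sets m2 = sets sphere_borel"
    and eq: "\<And>\<phi>::'a \<Rightarrow> real. continuous_on UNIV \<phi> \<Longrightarrow> integral\<^sup>L m1 \<phi> = integral\<^sup>L m2 \<phi>"
  shows "m1 = m2"
proof -
  have id: "(\<lambda>x. x) \<in> borel_measurable m" if "sets m = sets sphere_borel" for m :: "'a measure"
    by (rule borel_measurable_sphere_prob[OF that]) simp
  have sp: "space m = sphere 0 1" if "sets m = sets sphere_borel" for m :: "'a measure"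
    using sets_eq_imp_space_eq[OF that] by simp
  have lim: "(\<lambda>k. integral\<^sup>L m (\<lambda>x. max 0 (1 - real k * infdist x A)))
      \<longlonglongrightarrow> measure m (A \<inter> sphere 0 1)"
    if m: "prob_space m" "sets m = sets sphere_borel" and A: "closed A" "A \<noteq> {}" 
    for m :: "'a measure" and A
  proof -
    interpret prob_space m by fact
    have A': "A \<inter> sphere 0 1 \<in> sets m"
      using A m by (auto simp: sphere_borel_def sets_restrict_space)
    have "(\<lambda>k. integral\<^sup>L m (\<lambda>x. max 0 (1 - real k * infdist x A)))
      \<longlonglongrightarrow> integral\<^sup>L m (indicator (A \<inter> sphere 0 1) :: 'a \<Rightarrow> real)"
    proof (rule integral_dominated_convergence[where w="\<lambda>_. 1"])
      show "indicator (A \<inter> sphere 0 1) \<in> borel_measurable m" using A' by measurable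
      show "(\<lambda>x. max 0 (1 - real k * infdist x A)) \<in> borel_measurable m" for k
        by (intro borel_measurable_sphere_prob[OF m(2)] borel_measurable_continuous_onI continuous_intros)
      show "integrable m (\<lambda>_. 1 :: real)" by simp
      show "AE x in m. norm (max 0 (1 - real k * infdist x A)) \<le> 1" for k
        by (auto simp: infdist_nonneg)
      show "AE x in m. (\<lambda>k. max 0 (1 - real k * infdist x A)) \<longlonglongrightarrow> indicator (A \<inter> sphere 0 1) x"
      proof (rule AE_I2)
        fix x assume "x \<in> space m"
        then have x: "x \<in> sphere 0 1" using sp[OF m(2)] by simp
        show "(\<lambda>k. max 0 (1 - real k * infdist x A)) \<longlonglongrightarrow> indicator (A \<inter> sphere 0 1) x"
        proof (cases "x \<in> A")
          case True
          then show ?thesis using x by (simp add: indicator_def)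
        next
          case False
          then have pos: "infdist x A > 0"
            using A by (metis in_closed_iff_infdist_zero infdist_nonneg less_eq_real_def)
          obtain k0 :: nat where k0: "1 < real k0 * infdist x A"
            using pos reals_Archimedean3 by blast
          have "\<forall>\<^sub>F k in sequentially. max 0 (1 - real k * infdist x A) = 0"
            using eventually_ge_at_top[of k0]
          proof eventually_elim
            case (elim k)
            then have "real k0 * infdist x A \<le> real k * infdist x A"
              using pos by (intro mult_right_mono) auto
            with k0 show ?case by simp
          qed
          then show ?thesis using False
            by (simp add: indicator_def tendsto_eventually)
        qed
      qed
    qed
    then show ?thesis using A' by simp
  qed
  have closed_eq: "emeasure m1 (A \<inter> sphere 0 1) = emeasure m2 (A \<inter> sphere 0 1)" 
    if A: "closed A" for A
  proof (cases "A = {}")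
    case False
    interpret p1: prob_space m1 by fact
    interpret p2: prob_space m2 by fact
    have "integral\<^sup>L m1 (\<lambda>x. max 0 (1 - real k * infdist x A)) 
        = integral\<^sup>L m2 (\<lambda>x. max 0 (1 - real k * infdist x A))" for k
      by (rule eq) (intro continuous_intros)
    then have "measure m1 (A \<inter> sphere 0 1) = measure m2 (A \<inter> sphere 0 1)"
      using lim[OF p(1) s(1) A False] lim[OF p(2) s(2) A False] LIMSEQ_unique by simp
    then show ?thesis by (simp add: p1.emeasure_eq_measure p2.emeasure_eq_measure)
  qed simp
  have d: "distr m1 borel (\<lambda>x. x) = distr m2 borel (\<lambda>x. x)"
  proof (rule measure_eqI_generator_eq[where \<Omega>=UNIV and E="Collect closed" and A="\<lambda>_. UNIV"])
    show "Int_stable (Collect (closed :: 'a set \<Rightarrow> bool))"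
      by (auto simp: Int_stable_def)
    show "emeasure (distr m1 borel (\<lambda>x. x)) X = emeasure (distr m2 borel (\<lambda>x. x)) X" 
      if "X \<in> Collect closed" for X
      using that closed_eq[of X] s by (simp add: emeasure_distr id sp)
    show "emeasure (distr m1 borel (\<lambda>x. x)) UNIV \<noteq> \<infinity>"
      using id[OF s(1)] p(1) by (simp add: emeasure_distr prob_space.emeasure_space_1)
  qed (auto simp: borel_eq_closed)
  show ?thesis
  proof (rule measure_eqI)
    fix A assume "A \<in> sets m1"
    then have A: "A \<in> sets borel" "A \<subseteq> sphere 0 1"
      using s by (auto simp: sphere_borel_def sets_restrict_space)
    have "emeasure (distr m borel (\<lambda>x. x)) A = emeasure m A" 
      if "sets m = sets sphere_borel" for m :: "'a measure"
      using A id[OF that] sp[OF that] by (simp add: emeasure_distr Int_absorb2)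
    then show "emeasure m1 A = emeasure m2 A" using d s by metis
  qed (use s in simp)
qed

inductive_set exp_sums :: "('a::euclidean_space \<Rightarrow> real) set" where
  exp_sums_base: "(\<lambda>x. c * exp (x \<bullet> \<xi>)) \<in> exp_sums"
| exp_sums_add: "f \<in> exp_sums \<Longrightarrow> g \<in> exp_sums \<Longrightarrow> (\<lambda>x. f x + g x) \<in> exp_sums"

lemma exp_sums_continuous: "f \<in> exp_sums \<Longrightarrow> continuous_on A f"
  by (induction rule: exp_sums.induct) (auto intro!: continuous_intros)

lemma exp_sums_mult: 
  assumes "f \<in> exp_sums" "g \<in> exp_sums"
  shows "(\<lambda>x. f x * g x) \<in> exp_sums"
  using assms(1)
proof induction
  case (exp_sums_base c \<xi>)
  show ?case using assms(2)
  proof induction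
    case (exp_sums_base c' \<xi>')
    show ?case
      using exp_sums.exp_sums_base[of "c * c'" "\<xi> + \<xi>'"]
      by (simp add: inner_add_right exp_add mult_ac)
  next
    case (exp_sums_add f g)
    then show ?case using exp_sums.exp_sums_add by (fastforce simp: distrib_left)
  qed
next
  case (exp_sums_add f1 f2)
  then show ?case using exp_sums.exp_sums_add by (fastforce simp: distrib_right)
qed

lemma function_ring_on_exp_sums: "function_ring_on exp_sums (sphere (0::'a::euclidean_space) 1)"
proof
  show "(\<lambda>_. c) \<in> exp_sums" for c :: real
    using exp_sums_base[of c 0] by simp
  fix x y :: 'a assume "x \<noteq> y"
  then have "(x - y) \<bullet> (x - y) \<noteq> 0" by simp
  then have "x \<bullet> (x - y) \<noteq> y \<bullet> (x - y)" by (simp add: inner_diff_left)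
  then show "\<exists>f\<in>exp_sums. f x \<noteq> f y"
    by (intro bexI[OF _ exp_sums_base[of 1 "x - y"]]) simp
qed (auto intro: exp_sums_continuous exp_sums_add exp_sums_mult)

lemma invariant_prob_orthogonal_unique:
  fixes m1 m2 :: "(real^'n) measure"
  assumes m: "invariant_prob {T. orthogonal_transformation T} m1" 
    "invariant_prob {T. orthogonal_transformation T} m2"
  shows "m1 = m2"
proof -
  have p: "prob_space m1" "prob_space m2"
    and s: "sets m1 = sets sphere_borel" "sets m2 = sets sphere_borel"
    using m by (auto simp: invariant_prob_def)
  interpret p1: prob_space m1 by fact
  interpret p2: prob_space m2 by fact
  interpret P: pair_sigma_finite m1 m2 ..
  have id[measurable]: "(\<lambda>x. x) \<in> borel_measurable m1" "(\<lambda>x. x) \<in> borel_measurable m2"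
    by (simp_all add: s borel_measurable_sphere_prob)
  have sp: "space m1 = sphere 0 1" "space m2 = sphere 0 1"
    using sets_eq_imp_space_eq[OF s(1)] sets_eq_imp_space_eq[OF s(2)] by auto
  define H :: "(real^'n) measure \<Rightarrow> real^'n \<Rightarrow> ennreal" 
    where "H = (\<lambda>m \<xi>. \<integral>\<^sup>+x. ennreal (exp (x \<bullet> \<xi>)) \<partial>m)"
  have meas: "(\<lambda>x. ennreal (exp (x \<bullet> \<xi>))) \<in> borel_measurable sphere_borel" for \<xi> :: "real^'n"
    by (rule sphere_in_sphere_borel) simp
  have H_norm: "H m \<xi> = H m \<eta>" if inv: "invariant_prob {T. orthogonal_transformation T} m"
    and "norm \<xi> = norm \<eta>" for m \<xi> \<eta>
  proof -
    obtain T where T: "orthogonal_transformation T" "T \<xi> = \<eta>"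
      using orthogonal_transformation_exists[OF \<open>norm \<xi> = norm \<eta>\<close>] by blast
    have sm: "sets m = sets sphere_borel" and d: "distr m sphere_borel T = m"
      using inv T by (auto simp: invariant_prob_def)
    have "H m \<eta> = (\<integral>\<^sup>+x. ennreal (exp (x \<bullet> \<eta>)) \<partial>distr m sphere_borel T)"
      by (simp add: H_def d)
    also have "\<dots> = (\<integral>\<^sup>+x. ennreal (exp (T x \<bullet> \<eta>)) \<partial>m)"
      using orthogonal_sphere_borel[OF T(1)] meas
      by (intro nn_integral_distr) (simp_all add: sm cong: measurable_cong_sets)
    also have "\<dots> = H m \<xi>"
      using T by (auto simp: H_def orthogonal_transformation_def)
    finally show ?thesis by simp
  qed
  have H_eq: "H m1 \<xi> = H m2 \<xi>" for \<xi>
  proof -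
    define t where "t = norm \<xi>"
    have nt: "norm (t *\<^sub>R y) = norm \<xi>" if "y \<in> sphere 0 1" for y :: "real^'n"
      using that by (simp add: t_def)
    have f[measurable]: "(\<lambda>z. fst z) \<in> borel_measurable (m1 \<Otimes>\<^sub>M m2)" 
      "(\<lambda>z. snd z) \<in> borel_measurable (m1 \<Otimes>\<^sub>M m2)"
      using measurable_compose[OF measurable_fst id(1)] measurable_compose[OF measurable_snd id(2)] 
      by auto
    have "H m1 \<xi> = (\<integral>\<^sup>+y. H m1 \<xi> \<partial>m2)"
      by (simp add: p2.emeasure_space_1)
    also have "\<dots> = (\<integral>\<^sup>+y. (\<integral>\<^sup>+x. ennreal (exp (t * (x \<bullet> y))) \<partial>m1) \<partial>m2)"
    proof (rule nn_integral_cong)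
      fix y assume "y \<in> space m2"
      then have "H m1 \<xi> = H m1 (t *\<^sub>R y)" using sp nt by (intro H_norm m) simp
      then show "H m1 \<xi> = (\<integral>\<^sup>+x. ennreal (exp (t * (x \<bullet> y))) \<partial>m1)" by (simp add: H_def)
    qed
    also have "\<dots> = (\<integral>\<^sup>+x. (\<integral>\<^sup>+y. ennreal (exp (t * (x \<bullet> y))) \<partial>m2) \<partial>m1)"
      by (rule P.Fubini') (simp add: case_prod_beta)
    also have "\<dots> = (\<integral>\<^sup>+x. H m2 \<xi> \<partial>m1)"
    proof (rule nn_integral_cong)
      fix x assume "x \<in> space m1"
      then have "H m2 \<xi> = H m2 (t *\<^sub>R x)" using sp nt by (intro H_norm m) simp
      then show "(\<integral>\<^sup>+y. ennreal (exp (t * (x \<bullet> y))) \<partial>m2) = H m2 \<xi>" 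
        by (simp add: H_def inner_commute)
    qed
    also have "\<dots> = H m2 \<xi>" by (simp add: p1.emeasure_space_1)
    finally show ?thesis .
  qed
  have int: "integrable m1 f \<and> integrable m2 f" if "continuous_on UNIV f" for f :: "real^'n \<Rightarrow> real"
    using that p s integrable_sphere_continuous by blast
  have exp_eq: "integral\<^sup>L m1 f = integral\<^sup>L m2 f" if "f \<in> exp_sums" for f
    using that
  proof induction
    case (exp_sums_base c \<xi>)
    have "integral\<^sup>L m (\<lambda>x. exp (x \<bullet> \<xi>)) = enn2real (H m \<xi>)" 
      if "sets m = sets sphere_borel" for m
      unfolding H_def
      by (rule integral_eq_nn_integral) (auto intro!: borel_measurable_sphere_prob[OF that])
    then show ?case using s H_eq by simp
  next
    case (exp_sums_add f g)
    then show ?case using int[OF exp_sums_continuous] by simp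
  qed
  interpret R: function_ring_on exp_sums "sphere (0::real^'n) 1" by (rule function_ring_on_exp_sums)
  show ?thesis
  proof (rule sphere_measure_eqI[OF p s])
    fix \<phi> :: "real^'n \<Rightarrow> real" assume \<phi>: "continuous_on UNIV \<phi>"
    have "\<bar>integral\<^sup>L m1 \<phi> - integral\<^sup>L m2 \<phi>\<bar> \<le> 2 * e" if "e > 0" for e
    proof -
      obtain g where g: "g \<in> exp_sums" "\<And>x. x \<in> sphere 0 1 \<Longrightarrow> \<bar>\<phi> x - g x\<bar> < e"
        using R.Stone_Weierstrass_basic[OF _ \<open>e > 0\<close>, of \<phi>] continuous_on_subset[OF \<phi>] by auto
      have close: "\<bar>integral\<^sup>L m \<phi> - integral\<^sup>L m g\<bar> \<le> e" 
        if m: "prob_space m" "space m = sphere 0 1" and i: "integrable m \<phi>" "integrable m g" for m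
      proof -
        interpret prob_space m by fact
        have "\<bar>integral\<^sup>L m \<phi> - integral\<^sup>L m g\<bar> = \<bar>integral\<^sup>L m (\<lambda>x. \<phi> x - g x)\<bar>" using i by simp
        also have "\<dots> \<le> integral\<^sup>L m (\<lambda>x. \<bar>\<phi> x - g x\<bar>)" by (rule integral_abs_bound)
        also have "\<dots> \<le> integral\<^sup>L m (\<lambda>_. e)"
          using i g(2) m(2) by (intro integral_mono) (auto intro: less_imp_le)
        finally show ?thesis by (simp add: prob_space)
      qed
      have "\<bar>integral\<^sup>L m1 \<phi> - integral\<^sup>L m1 g\<bar> \<le> e" "\<bar>integral\<^sup>L m2 \<phi> - integral\<^sup>L m2 g\<bar> \<le> e"
        using int[OF \<phi>] int[OF exp_sums_continuous[OF g(1)]] p sp close by auto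
      then show ?thesis using exp_eq[OF g(1)] by linarith
    qed
    from this[of "\<bar>integral\<^sup>L m1 \<phi> - integral\<^sup>L m2 \<phi>\<bar> / 4"]
    show "integral\<^sup>L m1 \<phi> = integral\<^sup>L m2 \<phi>" by (cases "integral\<^sup>L m1 \<phi> = integral\<^sup>L m2 \<phi>") auto
  qed
qed

lemma invariant_prob_sphere_prob:
  "invariant_prob {T. orthogonal_transformation T} (sphere_prob :: (real^'n) measure)"
proof -
  have "\<exists>!m::(real^'n) measure. invariant_prob {T. orthogonal_transformation T} m"
    using ex_invariant_prob_orthogonal invariant_prob_orthogonal_unique by blast
  then show ?thesis
    unfolding sphere_prob_def by (rule theI')
qed

lemma invariant_prob_circle_unique:
  assumes m: "invariant_prob ((\<lambda>z w. z * w) ` sphere 0 1) m1" 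
    "invariant_prob ((\<lambda>z w. z * w) ` sphere 0 1) (m2 :: complex measure)"
  shows "m1 = m2"
proof (rule measure_eqI)
  have s: "sets m1 = sets sphere_borel" "sets m2 = sets sphere_borel"
    using m by (auto simp: invariant_prob_def)
  have "prob_space m1" "prob_space m2" using m by (auto simp: invariant_prob_def)
  then interpret p1: prob_space m1 + p2: prob_space m2 .
  interpret P: pair_sigma_finite m1 m2 ..
  have sp: "space m1 = sphere 0 1" "space m2 = sphere 0 1"
    using sets_eq_imp_space_eq[OF s(1)] sets_eq_imp_space_eq[OF s(2)] by auto
  show "sets m1 = sets m2" using s by simp
  fix A assume "A \<in> sets m1"
  then have A: "A \<in> sets borel" "A \<in> sets sphere_borel"
    using s by (auto simp: sphere_borel_def sets_restrict_space)
  note A(1)[measurable]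
  have id[measurable]: "(\<lambda>x. x) \<in> borel_measurable m1" "(\<lambda>x. x) \<in> borel_measurable m2"
    by (simp_all add: s borel_measurable_sphere_prob)
  have f[measurable]: "(\<lambda>z. fst z) \<in> borel_measurable (m1 \<Otimes>\<^sub>M m2)" 
    "(\<lambda>z. snd z) \<in> borel_measurable (m1 \<Otimes>\<^sub>M m2)"
    using measurable_compose[OF measurable_fst id(1)] measurable_compose[OF measurable_snd id(2)] 
    by auto
  have inv: "emeasure m A = (\<integral>\<^sup>+w. indicator A (z * w) \<partial>m)" 
    if "invariant_prob ((\<lambda>z w. z * w) ` sphere 0 1) m" "z \<in> sphere 0 1" for m z
  proof -
    have sm: "sets m = sets sphere_borel" and d: "distr m sphere_borel (\<lambda>w. z * w) = m"
      using that by (auto simp: invariant_prob_def)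
    have meas: "(\<lambda>w. z * w) \<in> measurable m sphere_borel"
      unfolding sphere_borel_def
    proof (rule measurable_restrict_space2)
      show "(\<lambda>w. z * w) \<in> borel_measurable m" by (rule borel_measurable_sphere_prob[OF sm]) simp
      show "(\<lambda>w. z * w) \<in> space m \<rightarrow> sphere 0 1" 
        using sets_eq_imp_space_eq[OF sm] that(2) by (auto simp: norm_mult)
    qed
    have "emeasure m A = emeasure (distr m sphere_borel (\<lambda>w. z * w)) A" by (simp add: d)
    also have "\<dots> = (\<integral>\<^sup>+w. indicator A w \<partial>distr m sphere_borel (\<lambda>w. z * w))" using A by simp
    also have "\<dots> = (\<integral>\<^sup>+w. indicator A (z * w) \<partial>m)"
      by (rule nn_integral_distr[OF meas]) (use A in simp)
    finally show ?thesis .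
  qed
  have "emeasure m1 A = (\<integral>\<^sup>+z. emeasure m1 A \<partial>m2)" by (simp add: p2.emeasure_space_1)
  also have "\<dots> = (\<integral>\<^sup>+z. (\<integral>\<^sup>+w. indicator A (z * w) \<partial>m1) \<partial>m2)"
    by (rule nn_integral_cong) (simp add: inv[OF m(1)] sp)
  also have "\<dots> = (\<integral>\<^sup>+w. (\<integral>\<^sup>+z. indicator A (z * w) \<partial>m2) \<partial>m1)"
    by (rule P.Fubini') (simp add: case_prod_beta)
  also have "\<dots> = (\<integral>\<^sup>+w. emeasure m2 A \<partial>m1)"
  proof (rule nn_integral_cong)
    fix w assume "w \<in> space m1"
    then show "(\<integral>\<^sup>+z. indicator A (z * w) \<partial>m2) = emeasure m2 A"
      using inv[OF m(2), of w] sp by (simp add: mult.commute)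
  qed
  also have "\<dots> = emeasure m2 A" by (simp add: p1.emeasure_space_1)
  finally show "emeasure m1 A = emeasure m2 A" .
qed

lemma invariant_prob_haar_circle: "invariant_prob ((\<lambda>z w. z * w) ` sphere 0 1) haar_circle"
proof -
  have orth: "orthogonal_transformation (\<lambda>w. z * w)" if "z \<in> sphere 0 1" for z :: complex
  proof -
    have "linear (\<lambda>w. z * w)" by (intro linearI) (simp_all add: algebra_simps)
    then show ?thesis using that by (simp add: orthogonal_transformation norm_mult)
  qed
  obtain m :: "complex measure" where "invariant_prob {T. orthogonal_transformation T} m"
    using ex_invariant_prob_orthogonal by blast
  with orth have "invariant_prob ((\<lambda>z w. z * w) ` sphere 0 1) m"
    unfolding invariant_prob_def by blast
  then have "\<exists>!m. invariant_prob ((\<lambda>z w. z * w) ` sphere 0 1) (m :: complex measure)"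
    using invariant_prob_circle_unique by blast
  then show ?thesis
    unfolding haar_circle_def by (rule theI')
qed

end

theory Submission
  imports Defs
begin

text \<open>
  By Weyl's criterion (\<open>Weyl_criterion\<close>) the theorem amounts to a statement about exponential sums: for every
  integer \<open>k \<noteq> 0\<close> the mean of \<open>mod1 (k * f x)\<close> over the points \<open>x\<close> of the shifted lattice that lie in the
  cone and in the ball of radius \<open>R\<close> tends to \<open>0\<close> as \<open>R \<rightarrow> \<infinity>\<close>. Let \<open>h\<close> be the \<open>d\<close>-th derivative of \<open>f\<close> in
  the direction \<open>v\<close>.

  Far out in the cone, \<open>f\<close> restricted to an arithmetic progression with step \<open>v\<close> looks like a polynomial of
  degree \<open>d\<close> whose leading coefficient is \<open>h / d!\<close>. More precisely, by the mean value theorem the \<open>d\<close>-fold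
  forward difference of \<open>f\<close> at \<open>x\<close> is a value of \<open>h\<close> at a point of the segment from \<open>x\<close> to \<open>x + d v\<close>.
  Rescaling by \<open>1/R\<close> does not change this value, because \<open>h\<close> is homogeneous of degree \<open>0\<close>, but it shrinks the
  segment to a point. Hence, if \<open>x / R \<rightarrow> y\<close> for some interior point \<open>y\<close> of the cone, the differences at \<open>x\<close>
  converge to \<open>h y\<close>, by continuity (\<open>angular_limit_forward_diff\<close>).

  The value \<open>h y\<close> is irrational for almost every \<open>y\<close>: both kinds of measures \<open>\<mu>\<close> give mass \<open>0\<close> to the
  countable set of rational points of the circle, and \<open>\<mu>\<close> is the distribution of \<open>h\<close> modulo one
  (\<open>cap_prob_pushforward\<close>). Null sets of the sphere are the sets over which the cone is Lebesgue null
  (\<open>sphere_prob_null_iff\<close>), because the invariant measure is the radial projection of the uniform measure on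
  the ball.

  These two properties force the exponential sums to be small, by van der Corput differencing
  (\<open>mod1_scaled_sum_tendsto_0\<close>): the mean of \<open>mod1 (F x)\<close> is controlled by mean squares of averages over short
  blocks \<open>x, x + v, \<dots>, x + (N - 1) v\<close>. Expanding the square produces the functions \<open>F (x + i v) - F (x + j v)\<close>,
  whose differences of one order less converge to \<open>(i - j) h\<close>, which is again irrational almost everywhere;
  this is an induction on \<open>d\<close>. For \<open>d = 1\<close> the block average is asymptotically, up to a factor
  of modulus one, a geometric sum with ratio \<open>mod1 (h y)\<close> divided by \<open>N\<close>, and this tends to \<open>0\<close> as \<open>N \<rightarrow> \<infinity>\<close> because \<open>h y\<close> is irrational.

  The limits of lattice sums needed on the way come from one principle (\<open>lattice_sum_limit\<close>). A lattice sum is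
  the integral of a step function which is constant on the cells of the rescaled lattice, so that dominated
  convergence reduces its convergence to a pointwise statement about sequences with \<open>w R / R \<rightarrow> y\<close>, for almost
  every \<open>y\<close>. Boundary effects disappear in the limit since the frontier of the cone is negligible.
\<close>

section \<open>Reduction modulo one\<close>

lemma mod1_add: "mod1 (s + t) = mod1 s * mod1 t"
  by (simp add: mod1_def distrib_left cis_mult)

lemma norm_mod1 [simp]: "norm (mod1 t) = 1"
  by (simp add: mod1_def)

lemma cnj_mod1: "cnj (mod1 t) = mod1 (- t)"
  by (simp add: mod1_def cis_cnj)

lemma mod1_of_nat_mult: "mod1 (of_nat k * t) = mod1 t ^ k"
  using Complex.DeMoivre[of "2 * pi * t" k] by (simp add: mod1_def mult_ac)

lemma continuous_on_mod1 [continuous_intros]: "continuous_on A f \<Longrightarrow> continuous_on A (\<lambda>x. mod1 (f x))"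
  unfolding mod1_def cis_conv_exp by (intro continuous_intros)

lemma mod1_eq_iff: "mod1 s = mod1 t \<longleftrightarrow> s - t \<in> \<int>"
proof -
  have "mod1 s = mod1 t \<longleftrightarrow> mod1 (s - t) = 1"
    using mod1_add[of "s - t" t] norm_mod1[of t] by (auto simp del: norm_mod1)
  also have "\<dots> \<longleftrightarrow> cos (2 * pi * (s - t)) = 1"
    using cos_one_sin_zero[of "2 * pi * (s - t)"] by (auto simp: mod1_def complex_eq_iff)
  also have "\<dots> \<longleftrightarrow> s - t \<in> \<int>"
    by (auto simp: cos_one_2pi_int Ints_def)
  finally show ?thesis .
qed

text \<open>
  The partial sums of a geometric series with ratio \<open>mod1 \<theta> \<noteq> 1\<close> on the unit circle are bounded by
  \<open>2 / norm (mod1 \<theta> - 1)\<close>, independently of their length.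
\<close>

lemma mean_mod1_multiples_tendsto_0:
  assumes "\<theta> \<notin> \<rat>"
  shows "(\<lambda>N. (\<Sum>j<N. mod1 (of_nat j * \<theta>)) / of_nat N) \<longlonglongrightarrow> 0"
proof -
  have ne: "mod1 \<theta> \<noteq> 1"
    using assms Ints_subset_Rats mod1_eq_iff[of \<theta> 0] by (auto simp: mod1_def)
  have "norm ((\<Sum>j<N. mod1 (of_nat j * \<theta>)) / of_nat N) \<le> (2 / norm (mod1 \<theta> - 1)) / of_nat N" for N
  proof -
    have "norm (\<Sum>j<N. mod1 (of_nat j * \<theta>)) = norm (mod1 \<theta> ^ N - 1) / norm (mod1 \<theta> - 1)"
      by (simp add: mod1_of_nat_mult geometric_sum[OF ne] norm_divide)
    also have "\<dots> \<le> 2 / norm (mod1 \<theta> - 1)"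
      using norm_triangle_ineq4[of "mod1 \<theta> ^ N" 1] by (intro divide_right_mono) (auto simp: norm_power)
    finally have "norm (\<Sum>j<N. mod1 (of_nat j * \<theta>)) / real N \<le> 2 / norm (mod1 \<theta> - 1) / real N"
      by (rule divide_right_mono) simp
    then show ?thesis by (simp add: norm_divide)
  qed
  moreover have "(\<lambda>N. (2 / norm (mod1 \<theta> - 1)) / of_nat N) \<longlonglongrightarrow> 0"
    by (intro tendsto_divide_0[OF tendsto_const] filterlim_at_top_imp_at_infinity filterlim_real_sequentially)
  ultimately show ?thesis
    by (rule Lim_null_comparison[OF always_eventually, OF allI])
qed

section \<open>Lattice sums as integrals of step functions\<close>

definition floor_vec :: "real^'n \<Rightarrow> real^'n" where
  "floor_vec y = (\<chi> i. of_int \<lfloor>y $ i\<rfloor>)"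

lemma floor_vec_Ints: "floor_vec y $ i \<in> \<int>"
  by (simp add: floor_vec_def)

lemma floor_vec_eq_iff:
  "(\<forall>i. z $ i \<in> \<int>) \<Longrightarrow> floor_vec y = z \<longleftrightarrow> (\<forall>i. z $ i \<le> y $ i \<and> y $ i < z $ i + 1)"
proof -
  assume z: "\<forall>i. z $ i \<in> \<int>"
  have "of_int \<lfloor>y $ i\<rfloor> = z $ i \<longleftrightarrow> z $ i \<le> y $ i \<and> y $ i < z $ i + 1" for i
    using z[rule_format, of i] by (auto elim!: Ints_cases simp: floor_eq_iff)
  then show ?thesis by (simp add: floor_vec_def vec_eq_iff)
qed

lemma measurable_floor_vec [measurable]: "floor_vec \<in> borel_measurable borel"
proof (rule borel_measurable_euclidean_space[THEN iffD2], intro ballI)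
  fix b :: "real^'n" assume "b \<in> Basis"
  then obtain i where b: "b = axis i 1" by (auto simp: Basis_vec_def)
  have "(\<lambda>y::real^'n. y $ i) \<in> borel_measurable borel"
    by (intro borel_measurable_continuous_onI continuous_intros)
  then have "(\<lambda>y::real^'n. real_of_int \<lfloor>y $ i\<rfloor>) \<in> borel_measurable borel" by measurable
  then show "(\<lambda>y. floor_vec y \<bullet> b) \<in> borel_measurable borel"
    by (simp add: b inner_axis floor_vec_def)
qed

lemma norm_floor_vec_diff: "norm (y - floor_vec y :: real^'n) \<le> real CARD('n)"
proof -
  have "norm (y - floor_vec y) \<le> (\<Sum>i\<in>UNIV. \<bar>(y - floor_vec y) $ i\<bar>)"
    by (rule norm_le_l1_cart)
  also have "\<dots> \<le> (\<Sum>i\<in>(UNIV::'n set). 1)"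
  proof (rule sum_mono)
    show "\<bar>(y - floor_vec y) $ i\<bar> \<le> 1" for i
      by (simp add: floor_vec_def abs_le_iff) linarith
  qed
  finally show ?thesis by simp
qed

text \<open>
  The volume of a cell of the integer lattice rescaled by \<open>1 / R\<close>. The dimension is a type, and the argument
  \<open>itself\<close> carries it.
\<close>

definition cell_volume :: "'n::finite itself \<Rightarrow> real \<Rightarrow> real" where
  "cell_volume _ R = measure lborel {y::real^'n. floor_vec (R *\<^sub>R y) = 0}"

text \<open>
  All cells are translates of the cell at the origin.
\<close>

lemma emeasure_cell:
  fixes z :: "real^'n"
  assumes "R > 0" "\<forall>i. z $ i \<in> \<int>"
  shows "emeasure lborel {y. floor_vec (R *\<^sub>R y) = z} = ennreal (cell_volume TYPE('n) R)"
proof -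
  have cell: "{y. floor_vec (R *\<^sub>R y) = z'} \<in> sets borel" for z' :: "real^'n" by measurable
  have "(+) (z /\<^sub>R R) -` {y. floor_vec (R *\<^sub>R y) = z} = {y. floor_vec (R *\<^sub>R y) = 0}"
    using assms by (auto simp: floor_vec_eq_iff distrib_left mult.assoc[symmetric])
  then have "emeasure lborel {y. floor_vec (R *\<^sub>R y) = z} = emeasure lborel {y::real^'n. floor_vec (R *\<^sub>R y) = 0}"
    using cell[of z] emeasure_distr[of "(+) (z /\<^sub>R R)" lborel borel "{y. floor_vec (R *\<^sub>R y) = z}"]
    by (simp add: lborel_distr_plus)
  moreover have "{y::real^'n. floor_vec (R *\<^sub>R y) = 0} \<subseteq> cbox 0 (\<chi> i. 1 / R)"
    using assms(1) by (auto simp: floor_vec_eq_iff mem_box_cart field_simps zero_le_mult_iff less_imp_le)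
  then have "emeasure lborel {y::real^'n. floor_vec (R *\<^sub>R y) = 0} \<noteq> \<infinity>"
    using emeasure_mono[of "{y::real^'n. floor_vec (R *\<^sub>R y) = 0}" "cbox 0 (\<chi> i. 1 / R)" lborel]
      emeasure_lborel_cbox_finite[of 0 "(\<chi> i. 1 / R) :: real^'n"] by (auto simp: top_unique)
  ultimately show ?thesis
    by (simp add: cell_volume_def emeasure_eq_ennreal_measure)
qed

lemma cell_volume_pos:
  assumes "R > 0"
  shows "cell_volume TYPE('n::finite) R > 0"
proof -
  have "box 0 (\<chi> i::'n. 1 / R) \<subseteq> {y. floor_vec (R *\<^sub>R y) = 0}"
    using assms by (auto simp: floor_vec_eq_iff mem_box_cart field_simps intro: less_imp_le)
  then have "emeasure lborel (box 0 (\<chi> i::'n. 1 / R)) \<le> ennreal (cell_volume TYPE('n) R)"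
    using assms by (subst emeasure_cell[symmetric, of _ 0]) (auto intro: emeasure_mono)
  moreover have "box 0 (\<chi> i::'n. 1 / R) \<noteq> {}"
    using assms by (auto simp: interval_ne_empty_cart)
  then have "emeasure lborel (box 0 (\<chi> i::'n. 1 / R)) \<noteq> 0"
    using open_not_negligible[OF open_box, of 0 "\<chi> i::'n. 1 / R"]
    by (auto simp: negligible_iff_null_sets null_sets_def)
  ultimately show ?thesis
    by (metis ennreal_eq_0_iff le_zero_eq not_le)
qed

lemma finite_bounded_integer_vectors: "finite {z::real^'n. (\<forall>i. z $ i \<in> \<int>) \<and> norm z \<le> B}"
proof (rule finite_subset)
  show "{z::real^'n. (\<forall>i. z $ i \<in> \<int>) \<and> norm z \<le> B} \<subseteq>
      (\<lambda>f. \<chi> i. of_int (f i)) ` (UNIV \<rightarrow>\<^sub>E {-\<lceil>B\<rceil>..\<lceil>B\<rceil>})"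
  proof
    fix z :: "real^'n" assume z: "z \<in> {z. (\<forall>i. z $ i \<in> \<int>) \<and> norm z \<le> B}"
    have "\<lfloor>z $ i\<rfloor> \<in> {-\<lceil>B\<rceil>..\<lceil>B\<rceil>}" for i
      using z component_le_norm_cart[of z i] by (simp add: abs_le_iff) linarith
    moreover have "z = (\<chi> i. of_int \<lfloor>z $ i\<rfloor>)" using z by (auto simp: vec_eq_iff)
    ultimately show "z \<in> (\<lambda>f. \<chi> i. of_int (f i)) ` (UNIV \<rightarrow>\<^sub>E {-\<lceil>B\<rceil>..\<lceil>B\<rceil>})"
      by (intro image_eqI[where x="\<lambda>i. \<lfloor>z $ i\<rfloor>"]) auto
  qed
qed (simp add: finite_PiE)

lemma matrix_inv_cancel: "invertible M \<Longrightarrow> matrix_inv M *v (M *v x) = (x :: real^'n)"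
proof -
  assume "invertible M"
  then have "\<exists>A. M ** A = mat 1 \<and> A ** M = mat 1" by (simp add: invertible_def)
  then have "matrix_inv M ** M = mat 1" unfolding matrix_inv_def by (rule someI2_ex) simp
  then show ?thesis by (simp add: matrix_vector_mul_assoc)
qed

lemma finite_lattice_in_ball:
  fixes M :: "real^'n^'n"
  assumes "invertible M"
  shows "finite ((\<lambda>x. x + u) ` point_lattice M \<inter> cball 0 B)"
proof -
  obtain c where c: "\<And>x. norm (matrix_inv M *v x) \<le> norm x * c" "c > 0"
    using bounded_linear.pos_bounded[OF matrix_vector_mul_bounded_linear] by blast
  have "(\<lambda>x. x + u) ` point_lattice M \<inter> cball 0 B \<subseteq>
      (\<lambda>z. M *v z + u) ` {z. (\<forall>i. z $ i \<in> \<int>) \<and> norm z \<le> (B + norm u) * c}"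
  proof (clarsimp simp: point_lattice_def)
    fix z assume z: "\<forall>i. z $ i \<in> \<int>" "norm (M *v z + u) \<le> B"
    have "z = matrix_inv M *v (M *v z)"
      using assms by (simp add: matrix_inv_cancel)
    then have "norm z \<le> norm (M *v z) * c" using c(1) by metis
    also have "\<dots> \<le> (B + norm u) * c"
      using z(2) norm_triangle_ineq4[of "M *v z + u" u] c(2) by (intro mult_right_mono) auto
    finally show "M *v z + u \<in> (\<lambda>z. M *v z + u) ` {z. (\<forall>i. z $ i \<in> \<int>) \<and> norm z \<le> (B + norm u) * c}"
      using z(1) by auto
  qed
  then show ?thesis
    by (rule finite_subset) (intro finite_imageI finite_bounded_integer_vectors)
qed

lemma negligible_linear_preimage:
  fixes M :: "real^'n^'n"
  assumes "invertible M" "negligible N"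
  shows "negligible {y. M *v y \<in> N}"
proof -
  have "{y. M *v y \<in> N} \<subseteq> (*v) (matrix_inv M) ` N"
  proof
    fix y assume "y \<in> {y. M *v y \<in> N}"
    moreover have "y = matrix_inv M *v (M *v y)"
      using assms by (simp add: matrix_inv_cancel)
    ultimately show "y \<in> (*v) (matrix_inv M) ` N" by blast
  qed
  moreover have "negligible ((*v) (matrix_inv M) ` N)"
    by (intro negligible_differentiable_image_negligible assms order_refl
        linear_imp_differentiable_on matrix_vector_mul_linear)
  ultimately show ?thesis by (rule negligible_subset[rotated])
qed

lemma AE_linear_avoids:
  fixes M :: "real^'n^'n"
  assumes "invertible M" "negligible N"
  shows "AE y in lborel. M *v y \<notin> N"
proof -
  have "{y. M *v y \<in> N} \<in> null_sets lebesgue"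
    using negligible_linear_preimage[OF assms] by (simp add: negligible_iff_null_sets)
  then have "AE y in lebesgue. y \<notin> {y. M *v y \<in> N}" by (rule AE_not_in)
  then show ?thesis by (simp add: AE_completion_iff)
qed

text \<open>
  Averages are taken over the points of \<open>M \<int>\<^sup>n + u\<close> in the dilated window \<open>R X\<close>. Later \<open>X\<close> is the part of
  the cone inside the unit ball, and the negligible frontier takes the place of any regularity of \<open>X\<close>.
\<close>

locale lattice_window =
  fixes M :: "real^'n^'n" and u :: "real^'n" and X :: "(real^'n) set"
  assumes invertible: "invertible M"
    and window_bounded: "X \<subseteq> ball 0 1"
    and negligible_frontier: "negligible (frontier X)"
begin

definition points :: "(real^'n) set" where
  "points = (\<lambda>x. x + u) ` point_lattice M"

text \<open>
  The lattice point attached to the cell of the rescaled lattice that contains \<open>y\<close>.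
\<close>

definition sample :: "real \<Rightarrow> real^'n \<Rightarrow> real^'n" where
  "sample R y = M *v floor_vec (R *\<^sub>R y) + u"

lemma points_iff: "x \<in> points \<longleftrightarrow> (\<exists>z. x = M *v z + u \<and> (\<forall>i. z $ i \<in> \<int>))"
  unfolding points_def point_lattice_def by (auto simp: image_iff)

lemma sample_in_points: "sample R y \<in> points"
  using floor_vec_Ints points_iff unfolding sample_def by blast

lemma points_translate:
  assumes v: "v \<in> point_lattice M"
  shows "x + v \<in> points \<longleftrightarrow> x \<in> points"
proof -
  obtain z where z: "v = M *v z" "\<forall>i. z $ i \<in> \<int>" using v by (auto simp: point_lattice_def)
  have "x + v \<in> points" if px: "x \<in> points" for x
  proof -
    obtain y where y: "x = M *v y + u" "\<forall>i. y $ i \<in> \<int>" using px[unfolded points_iff] by blast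
    have "x + v = M *v (y + z) + u" "\<forall>i. (y + z) $ i \<in> \<int>"
      using y z by (auto simp: matrix_vector_right_distrib)
    then show ?thesis unfolding points_iff by blast
  qed
  moreover have "x - v \<in> points" if px: "x \<in> points" for x
  proof -
    obtain y where y: "x = M *v y + u" "\<forall>i. y $ i \<in> \<int>" using px[unfolded points_iff] by blast
    have "x - v = M *v (y - z) + u" "\<forall>i. (y - z) $ i \<in> \<int>"
      using y z by (auto simp: matrix_vector_mult_diff_distrib)
    then show ?thesis unfolding points_iff by blast
  qed
  from this[of "x + v"] have "x \<in> points" if "x + v \<in> points" using that by simp
  ultimately show ?thesis by blast
qed

lemma finite_points: "finite (points \<inter> cball 0 B)"
  unfolding points_def by (rule finite_lattice_in_ball[OF invertible])

lemma sample_close: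
  "\<exists>b\<ge>0. \<forall>R>0. \<forall>y. norm (sample R y /\<^sub>R R - M *v y) \<le> b / R"
proof -
  obtain c where c: "\<And>x. norm (M *v x) \<le> norm x * c" "c > 0"
    using bounded_linear.pos_bounded[OF matrix_vector_mul_bounded_linear] by blast
  define b where "b = real CARD('n) * c + norm u"
  show ?thesis
  proof (intro exI[of _ b] conjI allI impI)
    show "b \<ge> 0" using c(2) by (simp add: b_def)
    fix R :: real and y :: "real^'n" assume R: "R > 0"
    have "sample R y /\<^sub>R R - M *v y = (u - M *v (R *\<^sub>R y - floor_vec (R *\<^sub>R y))) /\<^sub>R R"
      using R by (simp add: sample_def matrix_vector_mult_diff_distrib algebra_simps
          linear_scale[OF matrix_vector_mul_linear])
    also have "norm \<dots> = norm (u - M *v (R *\<^sub>R y - floor_vec (R *\<^sub>R y))) / R"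
      using R by (simp add: divide_inverse mult.commute)
    also have "norm (u - M *v (R *\<^sub>R y - floor_vec (R *\<^sub>R y))) \<le> norm u + norm (R *\<^sub>R y - floor_vec (R *\<^sub>R y)) * c"
      by (rule order_trans[OF norm_triangle_ineq4 add_left_mono[OF c(1)]])
    also have "\<dots> \<le> b"
      unfolding b_def using mult_right_mono[OF norm_floor_vec_diff[of "R *\<^sub>R y"], of c] c(2) by simp
    finally show "norm (sample R y /\<^sub>R R - M *v y) \<le> b / R"
      using R by (simp add: divide_right_mono)
  qed
qed

lemma sample_limit: "((\<lambda>R. sample R y /\<^sub>R R) \<longlongrightarrow> M *v y) at_top"
proof -
  obtain b where b: "b \<ge> 0" "\<And>R y. R > 0 \<Longrightarrow> norm (sample R y /\<^sub>R R - M *v y) \<le> b / R"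
    using sample_close by auto
  have "((\<lambda>R. sample R y /\<^sub>R R - M *v y) \<longlongrightarrow> 0) at_top"
  proof (rule Lim_null_comparison)
    show "\<forall>\<^sub>F R in at_top. norm (sample R y /\<^sub>R R - M *v y) \<le> b / R"
      using eventually_gt_at_top[of 0] by eventually_elim (rule b(2))
    show "((\<lambda>R. b / R) \<longlongrightarrow> 0) at_top"
      by (intro tendsto_divide_0[OF tendsto_const] filterlim_at_top_imp_at_infinity filterlim_ident)
  qed
  then show ?thesis by (rule LIM_zero_cancel)
qed

lemma sample_bounded_imp_bounded:
  obtains L where "\<And>R y. R \<ge> 1 \<Longrightarrow> norm (sample R y) \<le> K * R \<Longrightarrow> norm y \<le> L"
proof -
  obtain b where b: "b \<ge> 0" "\<And>R y. R > 0 \<Longrightarrow> norm (sample R y /\<^sub>R R - M *v y) \<le> b / R"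
    using sample_close by auto
  obtain c where c: "\<And>x. norm (matrix_inv M *v x) \<le> norm x * c" "c > 0"
    using bounded_linear.pos_bounded[OF matrix_vector_mul_bounded_linear] by blast
  show ?thesis
  proof (rule that[of "(K + b) * c"])
    fix R y assume R: "R \<ge> 1" and s: "norm (sample R y) \<le> K * R"
    have "norm (M *v y) \<le> norm (sample R y /\<^sub>R R) + norm (sample R y /\<^sub>R R - M *v y)"
      using norm_triangle_ineq4[of "sample R y /\<^sub>R R" "sample R y /\<^sub>R R - M *v y"] by simp
    also have "norm (sample R y /\<^sub>R R) \<le> K"
      using R s by (simp add: field_simps)
    also have "norm (sample R y /\<^sub>R R - M *v y) \<le> b"
      using b(2)[of R y] R b(1) order_trans[OF _ divide_left_mono[of 1 R b]] by simp
    finally have "norm (M *v y) \<le> K + b" by simp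
    then have "norm (matrix_inv M *v (M *v y)) \<le> (K + b) * c"
      using c(1)[of "M *v y"] c(2) by (meson mult_right_mono less_imp_le order_trans)
    then show "norm y \<le> (K + b) * c"
      using invertible by (simp add: matrix_inv_cancel)
  qed
qed

lemma sample_fibre:
  assumes "R > 0" "x \<in> points"
  shows "{y. sample R y = x} \<in> sets lborel"
    and "emeasure lborel {y. sample R y = x} = ennreal (cell_volume TYPE('n) R)"
proof -
  obtain z where z: "x = M *v z + u" "\<forall>i. z $ i \<in> \<int>"
    using assms(2)[unfolded points_iff] by blast
  have "inj ((*v) M)"
    using invertible by (simp add: inj_matrix_vector_mult)
  then have *: "{y. sample R y = x} = {y. floor_vec (R *\<^sub>R y) = z}"
    by (auto simp: sample_def z inj_eq)
  show "{y. sample R y = x} \<in> sets lborel" unfolding * by measurable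
  show "emeasure lborel {y. sample R y = x} = ennreal (cell_volume TYPE('n) R)"
    unfolding * by (rule emeasure_cell[OF assms(1) z(2)])
qed

text \<open>
  Summing over lattice points and multiplying by the volume of a cell is integrating the step function
  \<open>y \<mapsto> \<Phi> R (sample R y)\<close>. Since \<open>sample R y / R \<rightarrow> M y\<close>, the assumption on sequences \<open>w\<close> with
  \<open>w R / R \<rightarrow> M y\<close> gives its pointwise limit; bounded values and supports in balls of radius \<open>K R\<close> give an
  integrable majorant.
\<close>

lemma lattice_sum_limit:
  fixes \<Phi> :: "real \<Rightarrow> real^'n \<Rightarrow> 'b::{banach, second_countable_topology}"
  assumes bound: "\<And>R x. R \<ge> 1 \<Longrightarrow> norm (\<Phi> R x) \<le> B"
    and support: "\<And>R x. R \<ge> 1 \<Longrightarrow> norm x > K * R \<Longrightarrow> \<Phi> R x = 0"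
    and meas: "\<Psi> \<in> borel_measurable lborel"
    and lim: "AE y in lborel. \<forall>w. ((\<lambda>R. w R /\<^sub>R R) \<longlongrightarrow> M *v y) at_top \<longrightarrow> ((\<lambda>R. \<Phi> R (w R)) \<longlongrightarrow> \<Psi> y) at_top"
  shows "((\<lambda>R. cell_volume TYPE('n) R *\<^sub>R (\<Sum>x\<in>points \<inter> cball 0 (K * R). \<Phi> R x)) \<longlongrightarrow> integral\<^sup>L lborel \<Psi>) at_top"
proof -
  define s where "s = (\<lambda>R y. if R \<ge> 1 then \<Phi> R (sample R y) else 0)"
  have s_sum: "s R = (\<lambda>y. \<Sum>x\<in>points \<inter> cball 0 (K * R). indicator {y. sample R y = x} y *\<^sub>R \<Phi> R x)"
    if R: "R \<ge> 1" for R
  proof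
    fix y
    have "(\<Sum>x\<in>points \<inter> cball 0 (K * R). indicator {y. sample R y = x} y *\<^sub>R \<Phi> R x)
        = (\<Sum>x\<in>points \<inter> cball 0 (K * R). if sample R y = x then \<Phi> R x else 0)"
      by (intro sum.cong) auto
    also have "\<dots> = \<Phi> R (sample R y)"
      using finite_points[of "K * R"] sample_in_points[of R y] support[OF R, of "sample R y"]
      by (auto simp: sum.delta')
    finally show "s R y = (\<Sum>x\<in>points \<inter> cball 0 (K * R). indicator {y. sample R y = x} y *\<^sub>R \<Phi> R x)"
      using R by (simp add: s_def)
  qed
  have fibre: "integrable lborel (indicator {y. sample R y = x} :: _ \<Rightarrow> real)" if "R \<ge> 1" "x \<in> points" for R x
    using that sample_fibre[of R x] by (intro integrable_real_indicator) auto
  have s_int: "integral\<^sup>L lborel (s R) = cell_volume TYPE('n) R *\<^sub>R (\<Sum>x\<in>points \<inter> cball 0 (K * R). \<Phi> R x)"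
    if R: "R \<ge> 1" for R
  proof -
    have "measure lborel {y. sample R y = x} = cell_volume TYPE('n) R" if "x \<in> points" for x
      using sample_fibre(2)[of R x] R that cell_volume_pos[of R, where 'n='n] by (simp add: measure_def)
    moreover have "integral\<^sup>L lborel (s R) =
        (\<Sum>x\<in>points \<inter> cball 0 (K * R). measure lborel {y. sample R y = x} *\<^sub>R \<Phi> R x)"
      unfolding s_sum[OF R] using fibre[OF R] by (subst Bochner_Integration.integral_sum) auto
    ultimately show ?thesis by (simp add: scaleR_sum_right)
  qed
  obtain L where L: "\<And>R y. R \<ge> 1 \<Longrightarrow> norm (sample R y) \<le> K * R \<Longrightarrow> norm y \<le> L"
    using sample_bounded_imp_bounded by metis
  have B: "B \<ge> 0" using bound[of 1 0] norm_ge_zero order_trans by blast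
  have "((\<lambda>R. integral\<^sup>L lborel (s R)) \<longlongrightarrow> integral\<^sup>L lborel \<Psi>) at_top"
  proof (rule integral_dominated_convergence_at_top[where w = "\<lambda>y. indicator (cball 0 L) y *\<^sub>R B"])
    show "\<Psi> \<in> borel_measurable lborel" by (rule meas)
    show "s R \<in> borel_measurable lborel" for R
    proof (cases "R \<ge> 1")
      case True
      then show ?thesis unfolding s_sum[OF True] using sample_fibre(1)[of R] by (auto intro!: borel_measurable_sum borel_measurable_scaleR borel_measurable_indicator)
    next
      case False
      then show ?thesis by (simp add: s_def)
    qed
    show "integrable lborel (\<lambda>y. indicator (cball 0 L) y *\<^sub>R B)"
      using emeasure_lborel_cball_finite[of 0 L]
      by (intro integrable_scaleR_left) (simp add: integrable_indicator_iff)
    show "AE y in lborel. ((\<lambda>R. s R y) \<longlongrightarrow> \<Psi> y) at_top"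
      using lim
    proof eventually_elim
      case (elim y)
      then have "((\<lambda>R. \<Phi> R (sample R y)) \<longlongrightarrow> \<Psi> y) at_top"
        using elim[rule_format, of "\<lambda>R. sample R y"] sample_limit by simp
      moreover have "\<forall>\<^sub>F R in at_top. s R y = \<Phi> R (sample R y)"
        using eventually_ge_at_top[of 1] by eventually_elim (simp add: s_def)
      ultimately show ?case by (simp add: tendsto_cong)
    qed
    show "\<forall>\<^sub>F R in at_top. AE y in lborel. norm (s R y) \<le> indicator (cball 0 L) y *\<^sub>R B"
      using eventually_ge_at_top[of 1]
    proof eventually_elim
      case (elim R)
      have "norm (s R y) \<le> indicator (cball 0 L) y *\<^sub>R B" for y
        using elim B bound[OF elim] L[OF elim, of y] support[OF elim, of "sample R y"]
        by (cases "norm (sample R y) \<le> K * R") (auto simp: s_def indicator_def)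
      then show ?case by simp
    qed
  qed
  moreover have "\<forall>\<^sub>F R in at_top. integral\<^sup>L lborel (s R) = cell_volume TYPE('n) R *\<^sub>R (\<Sum>x\<in>points \<inter> cball 0 (K * R). \<Phi> R x)"
    using eventually_ge_at_top[of 1] by eventually_elim (rule s_int)
  ultimately show ?thesis by (simp add: tendsto_cong)
qed

end

section \<open>Differencing along a lattice direction\<close>

definition forward_diff :: "'a::ab_group_add \<Rightarrow> ('a \<Rightarrow> 'b::ab_group_add) \<Rightarrow> 'a \<Rightarrow> 'b" where
  "forward_diff v F x = F (x + v) - F x"

definition block_mean :: "'a::real_vector \<Rightarrow> ('a \<Rightarrow> complex) \<Rightarrow> nat \<Rightarrow> 'a \<Rightarrow> complex" where
  "block_mean v a N x = (\<Sum>j<N. a (x + of_nat j *\<^sub>R v)) / of_nat N"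


lemma tendsto_shifted_argument:
  fixes w :: "real \<Rightarrow> 'a::real_normed_vector"
  assumes "((\<lambda>R. w R /\<^sub>R R) \<longlongrightarrow> y) at_top"
  shows "((\<lambda>R. (w R + v) /\<^sub>R R) \<longlongrightarrow> y) at_top"
proof -
  have "((\<lambda>R::real. inverse R) \<longlongrightarrow> 0) at_top" by (rule tendsto_inverse_0_at_top[OF filterlim_ident])
  from tendsto_scaleR[OF this tendsto_const[of v]] have "((\<lambda>R. v /\<^sub>R R) \<longlongrightarrow> 0) at_top" by simp
  then show ?thesis using tendsto_add[OF assms] by (fastforce simp: scaleR_add_right)
qed

context lattice_window
begin

definition window :: "real \<Rightarrow> (real^'n) set" where
  "window R = {x \<in> points. x /\<^sub>R R \<in> X}"

text \<open>
  Sums over the window, normalised by the volume of a cell instead of the number of points. This makes them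
  linear in the summand and lets them converge to integrals; the mean over the window is the quotient by the
  scaled sum of \<open>1\<close>.
\<close>

definition scaled_sum :: "real \<Rightarrow> (real^'n \<Rightarrow> 'b::real_vector) \<Rightarrow> 'b" where
  "scaled_sum R a = cell_volume TYPE('n) R *\<^sub>R (\<Sum>x\<in>window R. a x)"

definition window_integral :: "(real^'n \<Rightarrow> 'b::{banach, second_countable_topology}) \<Rightarrow> 'b" where
  "window_integral \<Psi> = (\<integral>y. indicator (interior X) (M *v y) *\<^sub>R \<Psi> (M *v y) \<partial>lborel)"

text \<open>
  \<open>E (x)\<close> approaches \<open>h (y)\<close> whenever \<open>x\<close> goes to infinity at speed \<open>R\<close> in the direction of an interior point
  \<open>y\<close> of the window. This mode of convergence ignores translations of \<open>x\<close> by fixed vectors, which is what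
  makes it compatible with differencing.
\<close>

definition angular_limit :: "(real^'n \<Rightarrow> 'b::topological_space) \<Rightarrow> (real^'n \<Rightarrow> 'b) \<Rightarrow> bool" where
  "angular_limit E h \<longleftrightarrow> (\<forall>y\<in>interior X. \<forall>w.
     ((\<lambda>R. w R /\<^sub>R R) \<longlongrightarrow> y) at_top \<longrightarrow> ((\<lambda>R. E (w R)) \<longlongrightarrow> h y) at_top)"

lemma window_subset: "R > 0 \<Longrightarrow> window R \<subseteq> points \<inter> cball 0 R"
  using window_bounded by (auto simp: window_def subset_eq divide_simps)

lemma finite_window: "R > 0 \<Longrightarrow> finite (window R)"
  using window_subset finite_points by (rule finite_subset)

lemma indicator_window_limit:
  assumes "y \<notin> frontier X" "(w \<longlongrightarrow> y) F"
  shows "((\<lambda>R. indicator X (w R) :: real) \<longlongrightarrow> indicator (interior X) y) F"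
proof (rule tendsto_eventually)
  have "open (interior X)" "open (- closure X)" by auto
  moreover have "y \<in> interior X \<or> y \<in> - closure X" using assms(1) by (auto simp: frontier_def)
  ultimately show "\<forall>\<^sub>F R in F. indicator X (w R) = (indicator (interior X) y :: real)"
  proof (elim disjE)
    assume y: "y \<in> interior X"
    have "\<forall>\<^sub>F R in F. w R \<in> interior X" using topological_tendstoD[OF assms(2) open_interior y] .
    then show ?thesis by eventually_elim (use y interior_subset in \<open>auto simp: indicator_def\<close>)
  next
    assume y: "y \<in> - closure X"
    have "\<forall>\<^sub>F R in F. w R \<in> - closure X" using topological_tendstoD[OF assms(2) _ y] by auto
    then show ?thesis
      by eventually_elim (use y interior_subset closure_subset in \<open>auto simp: indicator_def\<close>)
  qed
qed

text \<open>
  Points outside the window contribute nothing, and frontier points can be ignored as they form a null set, so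
  that only limits towards interior points of the window matter.
\<close>

lemma scaled_sum_limit:
  fixes b :: "real^'n \<Rightarrow> 'b::{banach, second_countable_topology}"
  assumes bound: "\<And>x. norm (b x) \<le> B"
    and cont: "continuous_on (interior X) \<Psi>"
    and lim: "angular_limit b \<Psi>"
  shows "((\<lambda>R. scaled_sum R b) \<longlongrightarrow> window_integral \<Psi>) at_top"
proof -
  define \<Phi> where "\<Phi> = (\<lambda>R x. indicator X (x /\<^sub>R R) *\<^sub>R b x)"
  have B: "B \<ge> 0" using bound[of 0] norm_ge_zero order_trans by blast
  have "((\<lambda>R. cell_volume TYPE('n) R *\<^sub>R (\<Sum>x\<in>points \<inter> cball 0 (1 * R). \<Phi> R x)) \<longlongrightarrow>
     (\<integral>y. indicator (interior X) (M *v y) *\<^sub>R \<Psi> (M *v y) \<partial>lborel)) at_top"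
  proof (rule lattice_sum_limit)
    show "norm (\<Phi> R x) \<le> B" for R x using bound B by (auto simp: \<Phi>_def indicator_def)
    show "\<Phi> R x = 0" if "R \<ge> 1" "norm x > 1 * R" for R x
      using that window_bounded by (auto simp: \<Phi>_def indicator_def subset_eq divide_simps)
    have "(\<lambda>x. indicator (interior X) x *\<^sub>R \<Psi> x) \<in> borel_measurable borel"
      by (rule borel_measurable_continuous_on_indicator[OF _ cont]) simp
    moreover have "(*v) M \<in> borel_measurable borel"
      by (intro borel_measurable_continuous_onI continuous_intros)
    ultimately show "(\<lambda>y. indicator (interior X) (M *v y) *\<^sub>R \<Psi> (M *v y)) \<in> borel_measurable lborel"
      by (auto dest: measurable_compose)
    show "AE y in lborel. \<forall>w. ((\<lambda>R. w R /\<^sub>R R) \<longlongrightarrow> M *v y) at_top \<longrightarrow>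
        ((\<lambda>R. \<Phi> R (w R)) \<longlongrightarrow> indicator (interior X) (M *v y) *\<^sub>R \<Psi> (M *v y)) at_top"
      using AE_linear_avoids[OF invertible negligible_frontier]
    proof eventually_elim
      case (elim y)
      show ?case
      proof (intro allI impI)
        fix w assume w: "((\<lambda>R. w R /\<^sub>R R) \<longlongrightarrow> M *v y) at_top"
        have ind: "((\<lambda>R. indicator X (w R /\<^sub>R R) :: real) \<longlongrightarrow> indicator (interior X) (M *v y)) at_top"
          by (rule indicator_window_limit[OF elim w])
        show "((\<lambda>R. \<Phi> R (w R)) \<longlongrightarrow> indicator (interior X) (M *v y) *\<^sub>R \<Psi> (M *v y)) at_top"
        proof (cases "M *v y \<in> interior X")
          case True
          then have "((\<lambda>R. b (w R)) \<longlongrightarrow> \<Psi> (M *v y)) at_top"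
            using lim w by (auto simp: angular_limit_def)
          then show ?thesis unfolding \<Phi>_def by (intro tendsto_scaleR ind)
        next
          case False
          have "((\<lambda>R. \<Phi> R (w R)) \<longlongrightarrow> 0) at_top"
          proof (rule Lim_null_comparison)
            show "\<forall>\<^sub>F R in at_top. norm (\<Phi> R (w R)) \<le> indicator X (w R /\<^sub>R R) * B"
              using bound by (auto simp: \<Phi>_def indicator_def)
            show "((\<lambda>R. indicator X (w R /\<^sub>R R) * B) \<longlongrightarrow> 0) at_top"
              using tendsto_mult_right[OF ind, of B] False by simp
          qed
          then show ?thesis using False by simp
        qed
      qed
    qed
  qed
  moreover have "\<forall>\<^sub>F R in at_top. (\<Sum>x\<in>points \<inter> cball 0 (1 * R). \<Phi> R x) = (\<Sum>x\<in>window R. b x)"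
    using eventually_gt_at_top[of 0]
  proof eventually_elim
    case (elim R)
    show ?case
      by (rule sum.mono_neutral_cong_right)
        (use finite_points[of R] window_subset[OF elim] in \<open>auto simp: \<Phi>_def window_def indicator_def\<close>)
  qed
  then have "\<forall>\<^sub>F R in at_top. cell_volume TYPE('n) R *\<^sub>R (\<Sum>x\<in>points \<inter> cball 0 (1 * R). \<Phi> R x) = scaled_sum R b"
    by eventually_elim (simp add: scaled_sum_def)
  ultimately show ?thesis by (simp add: window_integral_def tendsto_cong)
qed

text \<open>
  Translating the summand by a lattice vector is translating the window by the opposite vector. The two
  indicator functions differ, after rescaling, only near the frontier of the window.
\<close>

lemma scaled_sum_shift:
  fixes a :: "real^'n \<Rightarrow> 'b::{banach, second_countable_topology}"
  assumes bound: "\<And>x. norm (a x) \<le> B" and v: "v \<in> point_lattice M"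
  shows "((\<lambda>R. scaled_sum R (\<lambda>x. a (x + v)) - scaled_sum R a) \<longlongrightarrow> 0) at_top"
proof -
  define K where "K = 1 + norm v"
  define \<Phi> where "\<Phi> = (\<lambda>R x. (indicator X ((x - v) /\<^sub>R R) - indicator X (x /\<^sub>R R)) *\<^sub>R a x)"
  have B: "B \<ge> 0" using bound[of 0] norm_ge_zero order_trans by blast
  have KR: "R \<le> K * R" "R + norm v \<le> K * R" if "R \<ge> 1" for R
    using that mult_left_mono[OF that, of "norm v"] by (auto simp: K_def distrib_right)
  have out: "y /\<^sub>R R \<notin> X" if "R \<ge> 1" "norm y > R" for R y
    using that window_bounded by (auto simp: subset_eq divide_simps)
  have far: "norm (x - v) > R" "norm x > R" if "R \<ge> 1" "norm x > K * R" for R x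
    using that KR[OF that(1)] norm_triangle_ineq2[of x v] by linarith+
  have "((\<lambda>R. cell_volume TYPE('n) R *\<^sub>R (\<Sum>x\<in>points \<inter> cball 0 (K * R). \<Phi> R x)) \<longlongrightarrow>
     (\<integral>y. 0 \<partial>(lborel :: (real^'n) measure))) at_top"
  proof (rule lattice_sum_limit)
    show "norm (\<Phi> R x) \<le> B" for R x using bound[of x] B by (auto simp: \<Phi>_def indicator_def)
    show "\<Phi> R x = 0" if "R \<ge> 1" "norm x > K * R" for R x
      using far[OF that] out[OF that(1)] by (simp add: \<Phi>_def)
    show "AE y in lborel. \<forall>w. ((\<lambda>R. w R /\<^sub>R R) \<longlongrightarrow> M *v y) at_top \<longrightarrow> ((\<lambda>R. \<Phi> R (w R)) \<longlongrightarrow> 0) at_top"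
      using AE_linear_avoids[OF invertible negligible_frontier]
    proof eventually_elim
      case (elim y)
      show ?case
      proof (intro allI impI)
        fix w assume w: "((\<lambda>R. w R /\<^sub>R R) \<longlongrightarrow> M *v y) at_top"
        have "((\<lambda>R. indicator X ((w R - v) /\<^sub>R R) - indicator X (w R /\<^sub>R R) :: real) \<longlongrightarrow>
            indicator (interior X) (M *v y) - indicator (interior X) (M *v y)) at_top"
          using tendsto_shifted_argument[OF w, of "- v"]
          by (intro tendsto_diff indicator_window_limit elim w) simp
        then have lim: "((\<lambda>R. \<bar>indicator X ((w R - v) /\<^sub>R R) - indicator X (w R /\<^sub>R R)\<bar> * B) \<longlongrightarrow> 0) at_top"
          using tendsto_mult_left_zero[OF tendsto_rabs_zero] by fastforce
        show "((\<lambda>R. \<Phi> R (w R)) \<longlongrightarrow> 0) at_top"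
          by (rule Lim_null_comparison[OF _ lim])
            (auto simp: \<Phi>_def intro!: always_eventually mult_left_mono bound)
      qed
    qed
  qed simp
  moreover have "\<forall>\<^sub>F R in at_top. cell_volume TYPE('n) R *\<^sub>R (\<Sum>x\<in>points \<inter> cball 0 (K * R). \<Phi> R x) =
      scaled_sum R (\<lambda>x. a (x + v)) - scaled_sum R a"
    using eventually_ge_at_top[of 1]
  proof eventually_elim
    case (elim R)
    let ?P = "points \<inter> cball 0 (K * R)"
    have P: "x \<in> ?P \<longleftrightarrow> x \<in> points \<and> norm x \<le> K * R" for x by auto
    have "(\<Sum>x\<in>window R. a (x + v)) = (\<Sum>x\<in>(\<lambda>x. x + v) ` window R. a x)"
      by (subst sum.reindex) (auto simp: inj_on_def)
    also have "\<dots> = (\<Sum>x\<in>?P. indicator X ((x - v) /\<^sub>R R) *\<^sub>R a x)"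
    proof (rule sum.mono_neutral_cong_left)
      show "finite ?P" by (rule finite_points)
      show "(\<lambda>x. x + v) ` window R \<subseteq> ?P"
        using points_translate[OF v] far(1)[OF elim] out[OF elim]
        by (force simp: window_def not_less[symmetric])
      show "\<forall>x\<in>?P - (\<lambda>x. x + v) ` window R. indicator X ((x - v) /\<^sub>R R) *\<^sub>R a x = 0"
      proof
        fix x assume x: "x \<in> ?P - (\<lambda>x. x + v) ` window R"
        then have "x - v \<notin> window R" by (metis DiffD2 diff_add_cancel image_eqI)
        moreover have "x - v \<in> points" using x points_translate[OF v, of "x - v"] by simp
        ultimately show "indicator X ((x - v) /\<^sub>R R) *\<^sub>R a x = 0" by (simp add: window_def)
      qed
    qed (auto simp: window_def)
    finally have 1: "(\<Sum>x\<in>window R. a (x + v)) = (\<Sum>x\<in>?P. indicator X ((x - v) /\<^sub>R R) *\<^sub>R a x)" .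
    have 2: "(\<Sum>x\<in>window R. a x) = (\<Sum>x\<in>?P. indicator X (x /\<^sub>R R) *\<^sub>R a x)"
    proof (rule sum.mono_neutral_cong_left)
      show "window R \<subseteq> ?P"
        using far(2)[OF elim] out[OF elim] by (force simp: window_def not_less[symmetric])
    qed (auto simp: window_def finite_points)
    show ?case
      unfolding scaled_sum_def 1 2 \<Phi>_def by (simp add: scaleR_diff_left sum_subtractf scaleR_diff_right)
  qed
  ultimately show ?thesis by (simp add: tendsto_cong)
qed

lemma scaled_sum_sum: "scaled_sum R (\<lambda>x. \<Sum>j\<in>J. a j x) = (\<Sum>j\<in>J. scaled_sum R (a j))"
  unfolding scaled_sum_def by (subst sum.swap) (simp add: scaleR_sum_right)

lemma scaled_sum_divide:
  fixes a :: "real^'n \<Rightarrow> 'b::real_normed_field"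
  shows "scaled_sum R (\<lambda>x. a x / c) = scaled_sum R a / c"
  unfolding scaled_sum_def sum_divide_distrib[symmetric] by (simp add: divide_inverse)

lemma scaled_sum_of_real: "scaled_sum R (\<lambda>x. complex_of_real (a x)) = complex_of_real (scaled_sum R a)"
  by (simp add: scaled_sum_def scaleR_conv_of_real)

text \<open>
  The Cauchy-Schwarz inequality.
\<close>

lemma scaled_sum_norm_squared_le:
  fixes a :: "real^'n \<Rightarrow> 'b::real_normed_vector"
  assumes "R > 0"
  shows "(norm (scaled_sum R a))\<^sup>2 \<le> scaled_sum R (\<lambda>_. 1) * scaled_sum R (\<lambda>x. (norm (a x))\<^sup>2)"
proof -
  have "(norm (\<Sum>x\<in>window R. a x))\<^sup>2 \<le> (\<Sum>x\<in>window R. norm (a x))\<^sup>2"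
    by (intro power_mono norm_sum) auto
  also have "\<dots> \<le> (\<Sum>x\<in>window R. (norm (a x))\<^sup>2) * card (window R)"
    by (rule sum_squared_le_sum_of_squares)
  finally have "(cell_volume TYPE('n) R)\<^sup>2 * (norm (\<Sum>x\<in>window R. a x))\<^sup>2 \<le>
      (cell_volume TYPE('n) R)\<^sup>2 * ((\<Sum>x\<in>window R. (norm (a x))\<^sup>2) * card (window R))"
    by (intro mult_left_mono) auto
  then show ?thesis by (simp add: scaled_sum_def power_mult_distrib power2_eq_square mult_ac)
qed

lemma angular_limit_const: "angular_limit (\<lambda>_. c) (\<lambda>_. c)"
  by (simp add: angular_limit_def)

lemma scaled_sum_one_limit: "((\<lambda>R. scaled_sum R (\<lambda>_. 1 :: real)) \<longlongrightarrow> window_integral (\<lambda>_. 1)) at_top"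
  by (rule scaled_sum_limit[where B = 1]) (auto intro: angular_limit_const)

lemma lattice_of_nat_mult:
  assumes "v \<in> point_lattice M" shows "of_nat j *\<^sub>R v \<in> point_lattice M"
proof -
  obtain z where "v = M *v z" "\<forall>i. z $ i \<in> \<int>" using assms by (auto simp: point_lattice_def)
  then have "of_nat j *\<^sub>R v = M *v (of_nat j *\<^sub>R z)" "\<forall>i. (of_nat j *\<^sub>R z) $ i \<in> \<int>"
    by (auto simp: linear_scale[OF matrix_vector_mul_linear])
  then show ?thesis unfolding point_lattice_def by blast
qed

text \<open>
  The first half of van der Corput's argument. Replacing \<open>a\<close> by its mean over a block of fixed length changes
  the scaled sum only by boundary terms, and the Cauchy-Schwarz inequality bounds the sum of the block means
  by the sum of their squares.
\<close>

lemma scaled_sum_tendsto_0_if_block_means_small: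
  assumes bound: "\<And>x. norm (a x) \<le> 1" and v: "v \<in> point_lattice M"
    and small: "\<And>e. e > 0 \<Longrightarrow> \<exists>N\<ge>1. \<forall>\<^sub>F R in at_top. scaled_sum R (\<lambda>x. (norm (block_mean v a N x))\<^sup>2) \<le> e"
  shows "((\<lambda>R. scaled_sum R a) \<longlongrightarrow> 0) at_top"
proof (rule tendstoI)
  fix e :: real assume e: "e > 0"
  define c where "c = \<bar>window_integral (\<lambda>_. 1 :: real) :: real\<bar> + 1"
  have c: "c > 0" by (simp add: c_def add_nonneg_pos)
  have ev_c: "\<forall>\<^sub>F R in at_top. scaled_sum R (\<lambda>_. 1 :: real) < c"
    by (rule order_tendstoD(2)[OF scaled_sum_one_limit]) (simp add: c_def)
  have "(e / 2)\<^sup>2 / c > 0" using e c by simp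
  from small[OF this] obtain N where N: "N \<ge> 1"
    and ev_N: "\<forall>\<^sub>F R in at_top. scaled_sum R (\<lambda>x. (norm (block_mean v a N x))\<^sup>2) \<le> (e / 2)\<^sup>2 / c"
    by blast
  have eq: "(\<Sum>j<N. scaled_sum R (\<lambda>x. a (x + of_nat j *\<^sub>R v)) - scaled_sum R a) / of_nat N =
      scaled_sum R (block_mean v a N) - scaled_sum R a" for R
  proof -
    have "scaled_sum R (block_mean v a N) = (\<Sum>j<N. scaled_sum R (\<lambda>x. a (x + of_nat j *\<^sub>R v))) / of_nat N"
      unfolding block_mean_def[abs_def] scaled_sum_divide scaled_sum_sum ..
    then show ?thesis using N by (simp add: sum_subtractf diff_divide_distrib)
  qed
  have "((\<lambda>R. (\<Sum>j<N. scaled_sum R (\<lambda>x. a (x + of_nat j *\<^sub>R v)) - scaled_sum R a) / of_nat N) \<longlongrightarrow>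
      (\<Sum>j<N. 0) / of_nat N) at_top"
    using N by (intro tendsto_divide tendsto_sum tendsto_const scaled_sum_shift[OF bound] lattice_of_nat_mult[OF v]) auto
  then have "((\<lambda>R. scaled_sum R (block_mean v a N) - scaled_sum R a) \<longlongrightarrow> 0) at_top" unfolding eq by simp
  then have ev_d: "\<forall>\<^sub>F R in at_top. norm (scaled_sum R (block_mean v a N) - scaled_sum R a) < e / 2"
    using e tendstoD[of "\<lambda>R. scaled_sum R (block_mean v a N) - scaled_sum R a" 0 at_top "e / 2"] by simp
  show "\<forall>\<^sub>F R in at_top. dist (scaled_sum R a) 0 < e"
    using ev_c ev_N ev_d eventually_gt_at_top[of 0]
  proof eventually_elim
    case (elim R)
    have "0 \<le> scaled_sum R (\<lambda>x. (norm (block_mean v a N x))\<^sup>2)"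
      using cell_volume_pos[of R, where 'n='n] elim(4) by (simp add: scaled_sum_def sum_nonneg)
    then have "scaled_sum R (\<lambda>_. 1) * scaled_sum R (\<lambda>x. (norm (block_mean v a N x))\<^sup>2) \<le> c * ((e / 2)\<^sup>2 / c)"
      using elim(1,2) c by (intro mult_mono less_imp_le[OF elim(1)] elim(2)) simp_all
    also have "c * ((e / 2)\<^sup>2 / c) = (e / 2)\<^sup>2" using c by simp
    finally have "(norm (scaled_sum R (block_mean v a N)))\<^sup>2 \<le> (e / 2)\<^sup>2"
      using scaled_sum_norm_squared_le[OF elim(4), of "block_mean v a N"] by (rule order_trans[rotated])
    then have "norm (scaled_sum R (block_mean v a N)) \<le> e / 2" by (rule power2_le_imp_le) (use e in simp)
    then show ?case
      using elim(3) norm_triangle_ineq4[of "scaled_sum R (block_mean v a N)" "scaled_sum R (block_mean v a N) - scaled_sum R a"] by simp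
  qed
qed

lemma angular_limit_shift: "angular_limit E h \<Longrightarrow> angular_limit (\<lambda>x. E (x + v)) h"
  unfolding angular_limit_def
proof (intro ballI allI impI)
  fix y w
  assume lim: "\<forall>y\<in>interior X. \<forall>w. ((\<lambda>R. w R /\<^sub>R R) \<longlongrightarrow> y) at_top \<longrightarrow> ((\<lambda>R. E (w R)) \<longlongrightarrow> h y) at_top"
    and y: "y \<in> interior X" and w: "((\<lambda>R. w R /\<^sub>R R) \<longlongrightarrow> y) at_top"
  show "((\<lambda>R. E (w R + v)) \<longlongrightarrow> h y) at_top"
    using lim[rule_format, OF y, of "\<lambda>R. w R + v"] tendsto_shifted_argument[OF w, of v] by simp
qed

lemma angular_limit_diff:
  fixes h :: "real^'n \<Rightarrow> 'b::real_normed_vector"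
  shows "angular_limit E h \<Longrightarrow> angular_limit E' h' \<Longrightarrow> angular_limit (\<lambda>x. E x - E' x) (\<lambda>x. h x - h' x)"
  unfolding angular_limit_def by (auto intro: tendsto_diff)

lemma angular_limit_add:
  fixes h :: "real^'n \<Rightarrow> 'b::real_normed_vector"
  shows "angular_limit E h \<Longrightarrow> angular_limit E' h' \<Longrightarrow> angular_limit (\<lambda>x. E x + E' x) (\<lambda>x. h x + h' x)"
  unfolding angular_limit_def by (auto intro: tendsto_add)

text \<open>
  \<open>E (x + i v) - E x\<close> telescopes into \<open>i\<close> forward differences at translates of \<open>x\<close>, all of which have the
  same limit.
\<close>

lemma angular_limit_steps:
  fixes E h :: "real^'n \<Rightarrow> real"
  assumes "angular_limit (forward_diff v E) h"
  shows "angular_limit (\<lambda>x. E (x + of_nat i *\<^sub>R v) - E x) (\<lambda>y. of_nat i * h y)"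
proof (induction i)
  case 0
  then show ?case by (simp add: angular_limit_const)
next
  case (Suc i)
  have eq: "E (x + of_nat (Suc i) *\<^sub>R v) - E x =
      forward_diff v E (x + of_nat i *\<^sub>R v) + (E (x + of_nat i *\<^sub>R v) - E x)" for x
    by (simp add: forward_diff_def algebra_simps)
  have "angular_limit (\<lambda>x. forward_diff v E (x + of_nat i *\<^sub>R v) + (E (x + of_nat i *\<^sub>R v) - E x))
      (\<lambda>y. h y + of_nat i * h y)"
    by (rule angular_limit_add[OF angular_limit_shift[OF assms] Suc])
  then show ?case unfolding eq by (simp add: distrib_right)
qed

lemma forward_diff_iterate_shift_diff:
  "(forward_diff v ^^ d) (\<lambda>x. F (x + s) - F (x + t)) =
     (\<lambda>x. (forward_diff v ^^ d) F (x + s) - (forward_diff v ^^ d) F (x + t))"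
  by (induction d) (auto simp: forward_diff_def fun_eq_iff add_ac)

lemma window_preimage_finite: "emeasure lborel {y. M *v y \<in> interior X} < \<infinity>" "{y. M *v y \<in> interior X} \<in> sets borel"
proof -
  obtain c where c: "\<And>x. norm (matrix_inv M *v x) \<le> norm x * c" "c > 0"
    using bounded_linear.pos_bounded[OF matrix_vector_mul_bounded_linear] by blast
  have "{y. M *v y \<in> interior X} \<subseteq> cball 0 c"
  proof
    fix y assume "y \<in> {y. M *v y \<in> interior X}"
    then have "norm (M *v y) \<le> 1" using window_bounded interior_subset by fastforce
    then have "norm (M *v y) * c \<le> c" using c(2) by (simp add: mult_left_le_one_le)
    then show "y \<in> cball 0 c" using c(1)[of "M *v y"] by (simp add: matrix_inv_cancel[OF invertible])
  qed
  then have "emeasure lborel {y. M *v y \<in> interior X} \<le> emeasure lborel (cball (0 :: real^'n) c)"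
    by (intro emeasure_mono) auto
  then show "emeasure lborel {y. M *v y \<in> interior X} < \<infinity>"
    using emeasure_lborel_cball_finite[of "0 :: real^'n" c] by (simp add: le_less_trans less_top)
  have "open ((*v) M -` interior X)"
    by (intro open_vimage open_interior continuous_intros)
  then show "{y. M *v y \<in> interior X} \<in> sets borel" by (simp add: vimage_def)
qed

definition irrational_on_window :: "(real^'n \<Rightarrow> real) \<Rightarrow> bool" where
  "irrational_on_window h \<longleftrightarrow> (AE y in lborel. M *v y \<in> interior X \<longrightarrow> h (M *v y) \<notin> \<rat>)"

lemma irrational_on_window_mult:
  assumes "irrational_on_window h" "k \<noteq> 0"
  shows "irrational_on_window (\<lambda>y. of_int k * h y)"
  using assms(1) unfolding irrational_on_window_def
proof eventually_elim
  case (elim y)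
  then show ?case
    using Rats_divide[OF _ Rats_of_int, of "of_int k * h (M *v y)" k] assms(2) by auto
qed

text \<open>
  The limiting mean squares of the block averages in the case of first differences: for irrational \<open>h y\<close> the
  integrand tends to \<open>0\<close>, and it is bounded by \<open>1\<close> on a set of finite measure.
\<close>

lemma window_integral_means_tendsto_0:
  assumes cont: "continuous_on (interior X) h" and irr: "irrational_on_window h"
  shows "(\<lambda>N. window_integral (\<lambda>y. (norm ((\<Sum>j<N. mod1 (of_nat j * h y)) / of_nat N))\<^sup>2)) \<longlonglongrightarrow> 0"
proof -
  let ?G = "\<lambda>N t. (norm ((\<Sum>j<N. mod1 (of_nat j * t)) / of_nat N))\<^sup>2"
  have G_le: "?G N t \<le> 1" for N t
  proof -
    have "norm (\<Sum>j<N. mod1 (of_nat j * t)) \<le> real N"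
      using norm_sum[of "\<lambda>j. mod1 (of_nat j * t)" "{..<N}"] by simp
    then have "norm ((\<Sum>j<N. mod1 (of_nat j * t)) / of_nat N) \<le> 1"
      by (cases "N = 0") (simp_all add: norm_divide)
    then show ?thesis by (simp add: power_le_one)
  qed
  have "(\<lambda>N. (\<integral>y. indicator (interior X) (M *v y) *\<^sub>R ?G N (h (M *v y)) \<partial>lborel)) \<longlonglongrightarrow> (\<integral>y. 0 \<partial>(lborel :: (real^'n) measure))"
  proof (rule integral_dominated_convergence[where w = "indicator {y. M *v y \<in> interior X}"])
    show "integrable lborel (indicator {y. M *v y \<in> interior X} :: _ \<Rightarrow> real)"
      using window_preimage_finite by (intro integrable_real_indicator) auto
    show "(\<lambda>y. indicator (interior X) (M *v y) *\<^sub>R ?G N (h (M *v y))) \<in> borel_measurable lborel" for N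
    proof -
      have "(\<lambda>x. indicator (interior X) x *\<^sub>R ?G N (h x)) \<in> borel_measurable borel"
        by (cases "N = 0", simp, rule borel_measurable_continuous_on_indicator)
          (auto intro!: continuous_intros cont)
      moreover have "(*v) M \<in> borel_measurable borel"
        by (intro borel_measurable_continuous_onI continuous_intros)
      ultimately show ?thesis by (auto dest: measurable_compose)
    qed
    show "AE y in lborel. norm (indicator (interior X) (M *v y) *\<^sub>R ?G N (h (M *v y))) \<le> indicator {y. M *v y \<in> interior X} y" for N
      using G_le by (auto simp: indicator_def)
    show "AE y in lborel. (\<lambda>N. indicator (interior X) (M *v y) *\<^sub>R ?G N (h (M *v y))) \<longlonglongrightarrow> 0"
      using irr unfolding irrational_on_window_def
    proof eventually_elim
      case (elim y)
      show ?case
      proof (cases "M *v y \<in> interior X")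
        case True
        then have "(\<lambda>N. ?G N (h (M *v y))) \<longlonglongrightarrow> (norm (0::complex))\<^sup>2"
          using elim by (intro tendsto_power tendsto_norm mean_mod1_multiples_tendsto_0) auto
        then show ?thesis using True by simp
      qed simp
    qed
  qed simp
  then show ?thesis by (simp add: window_integral_def)
qed

text \<open>
  The exponential sum estimate, by induction on the order of the difference whose angular limit is known. Both
  \<open>F\<close> and \<open>h\<close> vary in the induction: a differencing step passes from \<open>h\<close> to a nonzero integer multiple of \<open>h\<close>
  and lowers the order by one.
\<close>

lemma mod1_scaled_sum_tendsto_0:
  assumes v: "v \<in> point_lattice M"
    and cont: "continuous_on (interior X) h" and irr: "irrational_on_window h"
    and lim: "angular_limit ((forward_diff v ^^ Suc d) F) h"
  shows "((\<lambda>R. scaled_sum R (\<lambda>x. mod1 (F x))) \<longlongrightarrow> 0) at_top"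
  using cont irr lim
proof (induction d arbitrary: F h)
  case 0
  let ?G = "\<lambda>N t. (norm ((\<Sum>j<N. mod1 (of_nat j * t)) / of_nat N))\<^sup>2"
  let ?b = "\<lambda>N x. (norm (block_mean v (\<lambda>x. mod1 (F x)) N x))\<^sup>2"
  \<comment> \<open>The factor \<open>mod1 (F x)\<close> common to the whole block has modulus one.\<close>
  have b_eq: "?b N x = (norm ((\<Sum>j<N. mod1 (F (x + of_nat j *\<^sub>R v) - F x)) / of_nat N))\<^sup>2" for N x
  proof -
    have "block_mean v (\<lambda>x. mod1 (F x)) N x = mod1 (F x) * ((\<Sum>j<N. mod1 (F (x + of_nat j *\<^sub>R v) - F x)) / of_nat N)"
      by (simp add: block_mean_def sum_distrib_left mod1_add[symmetric])
    then show ?thesis by (simp only: norm_mult norm_mod1 mult_1)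
  qed
  have lim_b: "((\<lambda>R. scaled_sum R (?b N)) \<longlongrightarrow> window_integral (\<lambda>y. ?G N (h y))) at_top" if N: "N \<ge> 1" for N
  proof (rule scaled_sum_limit[where B = 1])
    have "norm (block_mean v (\<lambda>x. mod1 (F x)) N x) \<le> 1" for x
      using norm_sum[of "\<lambda>j. mod1 (F (x + of_nat j *\<^sub>R v))" "{..<N}"]
      by (cases "N = 0") (simp_all add: block_mean_def norm_divide)
    then show "norm (?b N x) \<le> 1" for x by (simp add: power_le_one)
    show "continuous_on (interior X) (\<lambda>y. ?G N (h y))"
      using N by (auto intro!: continuous_intros 0)
    show "angular_limit (?b N) (\<lambda>y. ?G N (h y))"
      unfolding b_eq angular_limit_def
    proof (intro ballI allI impI)
      fix y w assume y: "y \<in> interior X" and w: "((\<lambda>R. w R /\<^sub>R R) \<longlongrightarrow> y) at_top"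
      have "angular_limit (forward_diff v F) h" using 0 by simp
      then have "((\<lambda>R. F (w R + of_nat j *\<^sub>R v) - F (w R)) \<longlongrightarrow> of_nat j * h y) at_top" for j
        using angular_limit_steps[of v F h j] y w by (simp add: angular_limit_def)
      moreover have "isCont mod1 t" for t
        using continuous_on_mod1[OF continuous_on_id, of UNIV] by (simp add: continuous_on_eq_continuous_at)
      ultimately have "((\<lambda>R. mod1 (F (w R + of_nat j *\<^sub>R v) - F (w R))) \<longlongrightarrow> mod1 (of_nat j * h y)) at_top" for j
        using isCont_tendsto_compose by blast
      then show "((\<lambda>R. (norm ((\<Sum>j<N. mod1 (F (w R + of_nat j *\<^sub>R v) - F (w R))) / of_nat N))\<^sup>2) \<longlongrightarrow> ?G N (h y)) at_top"
        using N by (intro tendsto_power tendsto_norm tendsto_divide tendsto_sum tendsto_const) auto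
    qed
  qed
  show ?case
  proof (rule scaled_sum_tendsto_0_if_block_means_small[OF _ v])
    fix e :: real assume "e > 0"
    then have "\<forall>\<^sub>F N in sequentially. window_integral (\<lambda>y. ?G N (h y)) < e"
      by (intro order_tendstoD(2)[OF window_integral_means_tendsto_0] 0)
    then obtain N where N: "N \<ge> 1" "window_integral (\<lambda>y. ?G N (h y)) < e"
      unfolding eventually_sequentially by (metis max.cobounded1 max.cobounded2)
    have "\<forall>\<^sub>F R in at_top. scaled_sum R (?b N) < e" by (rule order_tendstoD(2)[OF lim_b[OF N(1)] N(2)])
    then show "\<exists>N\<ge>1. \<forall>\<^sub>F R in at_top. scaled_sum R (?b N) \<le> e"
      using N(1) by (intro exI[of _ N]) (auto elim: eventually_mono)
  qed simp
next
  case (Suc d)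
  let ?a = "\<lambda>x. mod1 (F x)"
  let ?c = "window_integral (\<lambda>_. 1) :: real"
  \<comment> \<open>The correlations of two distinct translates vanish in the limit by the induction hypothesis, and only
    the \<open>N\<close> diagonal terms of the expanded square remain.\<close>
  have corr: "((\<lambda>R. scaled_sum R (\<lambda>x. ?a (x + of_nat i *\<^sub>R v) * cnj (?a (x + of_nat j *\<^sub>R v)))) \<longlongrightarrow>
      (if i = j then complex_of_real ?c else 0)) at_top" for i j
  proof (cases "i = j")
    case True
    have "?a x * cnj (?a x) = complex_of_real 1" for x
      using complex_norm_square[of "?a x"] by simp
    then show ?thesis
      using True tendsto_of_real[OF scaled_sum_one_limit, where 'a = complex] scaled_sum_of_real[of _ "\<lambda>_. 1"] by simp
  next
    case False
    let ?F = "\<lambda>x. F (x + of_nat i *\<^sub>R v) - F (x + of_nat j *\<^sub>R v)"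
    let ?E = "(forward_diff v ^^ Suc d) F"
    have "angular_limit (forward_diff v ?E) h" using Suc.prems by simp
    then have "angular_limit (\<lambda>x. (?E (x + of_nat i *\<^sub>R v) - ?E x) - (?E (x + of_nat j *\<^sub>R v) - ?E x))
        (\<lambda>y. of_nat i * h y - of_nat j * h y)"
      by (intro angular_limit_diff angular_limit_steps)
    then have "angular_limit ((forward_diff v ^^ Suc d) ?F) (\<lambda>y. of_int (int i - int j) * h y)"
      unfolding forward_diff_iterate_shift_diff by (simp add: left_diff_distrib)
    moreover have "irrational_on_window (\<lambda>y. of_int (int i - int j) * h y)"
      using False by (intro irrational_on_window_mult Suc.prems) auto
    moreover have "continuous_on (interior X) (\<lambda>y. of_int (int i - int j) * h y)"
      by (intro continuous_intros Suc.prems)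
    ultimately have "((\<lambda>R. scaled_sum R (\<lambda>x. mod1 (?F x))) \<longlongrightarrow> 0) at_top"
      using Suc.IH by blast
    then show ?thesis using False by (simp add: cnj_mod1 mod1_add[symmetric])
  qed
  show ?case
  proof (rule scaled_sum_tendsto_0_if_block_means_small[OF _ v])
    fix e :: real assume e: "e > 0"
    obtain N where N: "real N > ?c / e" "N \<ge> 1"
      using reals_Archimedean2[of "max (?c / e) 1"] by (metis less_eq_real_def max_less_iff_conj of_nat_1 of_nat_le_iff)
    let ?b = "\<lambda>x. (norm (block_mean v ?a N x))\<^sup>2"
    have b_eq: "complex_of_real (?b x) = (\<Sum>i<N. \<Sum>j<N. ?a (x + of_nat i *\<^sub>R v) * cnj (?a (x + of_nat j *\<^sub>R v))) / (of_nat N)\<^sup>2" for x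
      unfolding complex_norm_square block_mean_def
      by (simp add: sum_product power2_eq_square)
    have "complex_of_real (scaled_sum R ?b) =
        (\<Sum>i<N. \<Sum>j<N. scaled_sum R (\<lambda>x. ?a (x + of_nat i *\<^sub>R v) * cnj (?a (x + of_nat j *\<^sub>R v)))) / (of_nat N)\<^sup>2" for R
      unfolding scaled_sum_of_real[symmetric] b_eq by (simp add: scaled_sum_divide scaled_sum_sum)
    moreover have "((\<lambda>R. (\<Sum>i<N. \<Sum>j<N. scaled_sum R (\<lambda>x. ?a (x + of_nat i *\<^sub>R v) * cnj (?a (x + of_nat j *\<^sub>R v)))) / (of_nat N)\<^sup>2)
       \<longlongrightarrow> (\<Sum>i<N. \<Sum>j<N. if i = j then complex_of_real ?c else 0) / (of_nat N)\<^sup>2) at_top"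
      using N(2) by (intro tendsto_divide tendsto_sum corr tendsto_const) auto
    ultimately have "((\<lambda>R. complex_of_real (scaled_sum R ?b)) \<longlongrightarrow> complex_of_real (?c / real N)) at_top"
      using N(2) by (simp add: power2_eq_square)
    then have "((\<lambda>R. scaled_sum R ?b) \<longlongrightarrow> ?c / real N) at_top"
      using tendsto_Re by fastforce
    moreover have "?c / real N < e" using N e by (simp add: field_simps)
    ultimately have "\<forall>\<^sub>F R in at_top. scaled_sum R ?b < e" by (rule order_tendstoD(2))
    then show "\<exists>N\<ge>1. \<forall>\<^sub>F R in at_top. scaled_sum R (\<lambda>x. (norm (block_mean v ?a N x))\<^sup>2) \<le> e"
      using N(2) by (intro exI[of _ N]) (auto elim: eventually_mono)
  qed simp
qed

lemma window_integral_one_pos: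
  assumes "interior X \<noteq> {}"
  shows "window_integral (\<lambda>_. 1 :: real) > 0"
proof -
  obtain x where x: "x \<in> interior X" using assms by blast
  have "surj ((*v) M)" using invertible by (simp add: invertible_eq_bij bij_is_surj)
  then obtain y where "M *v y = x" by (metis surjD)
  then have "{y. M *v y \<in> interior X} \<noteq> {}" using x by blast
  moreover have "open ((*v) M -` interior X)"
    by (intro open_vimage open_interior continuous_intros)
  ultimately have "\<not> negligible {y. M *v y \<in> interior X}"
    by (intro open_not_negligible) (auto simp: vimage_def)
  then have "emeasure lborel {y. M *v y \<in> interior X} \<noteq> 0"
    using window_preimage_finite(2) by (auto simp: negligible_iff_null_sets null_sets_def)
  then have "measure lborel {y. M *v y \<in> interior X} > 0"
    using window_preimage_finite(1) by (simp add: measure_def enn2real_positive_iff zero_less_iff_neq_zero)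
  moreover have "window_integral (\<lambda>_. 1 :: real) = (\<integral>y. indicator {y. M *v y \<in> interior X} y \<partial>lborel)"
    unfolding window_integral_def by (intro Bochner_Integration.integral_cong) (auto simp: indicator_def)
  ultimately show ?thesis using window_preimage_finite(2) by simp
qed

lemma window_mean_tendsto_0:
  fixes a :: "real^'n \<Rightarrow> complex"
  assumes "interior X \<noteq> {}" "((\<lambda>R. scaled_sum R a) \<longlongrightarrow> 0) at_top"
  shows "((\<lambda>R. (\<Sum>x\<in>window R. a x) / of_nat (card (window R))) \<longlongrightarrow> 0) at_top"
proof -
  have "((\<lambda>R. scaled_sum R a / complex_of_real (scaled_sum R (\<lambda>_. 1))) \<longlongrightarrow> 0 / complex_of_real (window_integral (\<lambda>_. 1))) at_top"
    using window_integral_one_pos[OF assms(1)]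
    by (intro tendsto_divide tendsto_of_real assms scaled_sum_one_limit) auto
  moreover have "\<forall>\<^sub>F R in at_top. scaled_sum R a / complex_of_real (scaled_sum R (\<lambda>_. 1)) = (\<Sum>x\<in>window R. a x) / of_nat (card (window R))"
    using eventually_gt_at_top[of 0]
  proof eventually_elim
    case (elim R)
    then show ?case using cell_volume_pos[of R, where 'n='n] by (simp add: scaled_sum_def scaleR_conv_of_real)
  qed
  ultimately show ?thesis by (simp add: tendsto_cong)
qed

lemma window_eventually_nonempty:
  assumes "interior X \<noteq> {}"
  shows "\<forall>\<^sub>F R in at_top. finite (window R) \<and> window R \<noteq> {}"
  using order_tendstoD(1)[OF scaled_sum_one_limit window_integral_one_pos[OF assms]] eventually_gt_at_top[of 0]
  by eventually_elim (auto simp: scaled_sum_def finite_window)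

end

section \<open>Forward differences and directional derivatives\<close>

text \<open>
  The mean value theorem for iterated differences. The induction hypothesis is applied to the first differences
  of all the \<open>\<psi> i\<close>, which again form a chain of derivatives on an interval shorter by one.
\<close>

lemma forward_diff_mean_value:
  fixes \<psi> :: "nat \<Rightarrow> real \<Rightarrow> real"
  assumes "\<And>i t. i < d \<Longrightarrow> 0 \<le> t \<Longrightarrow> t \<le> real d \<Longrightarrow> (\<psi> i has_real_derivative \<psi> (Suc i) t) (at t)"
  shows "\<exists>\<xi>. 0 \<le> \<xi> \<and> \<xi> \<le> real d \<and> (forward_diff 1 ^^ d) (\<psi> 0) 0 = \<psi> d \<xi>"
  using assms
proof (induction d arbitrary: \<psi>)
  case 0
  then show ?case by auto
next
  case (Suc d)
  have "((\<lambda>t. forward_diff 1 (\<psi> i) t) has_real_derivative forward_diff 1 (\<psi> (Suc i)) t) (at t)"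
    if "i < d" "0 \<le> t" "t \<le> real d" for i t
  proof -
    have "((\<lambda>s. \<psi> i (s + 1)) has_real_derivative \<psi> (Suc i) (t + 1)) (at t)"
      using Suc.prems[of i "t + 1"] that by (subst DERIV_shift[symmetric]) simp
    then show ?thesis
      unfolding forward_diff_def using Suc.prems[of i t] that by (intro DERIV_diff) auto
  qed
  then obtain \<xi> where \<xi>: "0 \<le> \<xi>" "\<xi> \<le> real d"
    and eq: "(forward_diff 1 ^^ d) (forward_diff 1 (\<psi> 0)) 0 = forward_diff 1 (\<psi> d) \<xi>"
    using Suc.IH[of "\<lambda>i. forward_diff 1 (\<psi> i)"] by auto
  obtain z where "\<xi> < z" "z < \<xi> + 1" "\<psi> d (\<xi> + 1) - \<psi> d \<xi> = (\<xi> + 1 - \<xi>) * \<psi> (Suc d) z"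
    using MVT2[of \<xi> "\<xi> + 1" "\<psi> d" "\<psi> (Suc d)"] Suc.prems[of d] \<xi> by auto
  moreover from this have "forward_diff 1 (\<psi> d) \<xi> = \<psi> (Suc d) z" by (simp add: forward_diff_def)
  ultimately show ?case
    using \<xi> eq by (intro exI[of _ z]) (simp add: funpow_Suc_right del: funpow.simps)
qed

lemma forward_diff_along_line:
  fixes x v :: "'a::real_vector"
  shows
  "(forward_diff 1 ^^ d) (\<lambda>t. g (x + t *\<^sub>R v)) t = (forward_diff v ^^ d) g (x + t *\<^sub>R v)"
  by (induction d arbitrary: t) (auto simp: forward_diff_def scaleR_add_left add_ac)

text \<open>
  Iterated directional derivatives through Frechet derivatives, the form in which smoothness provides them. On an
  open set they agree with the one-dimensional derivatives in \<open>dir_deriv\<close>.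
\<close>

primrec iterated_deriv :: "real^'n \<Rightarrow> (real^'n \<Rightarrow> real) \<Rightarrow> nat \<Rightarrow> real^'n \<Rightarrow> real" where
  "iterated_deriv v g 0 = g"
| "iterated_deriv v g (Suc i) = (\<lambda>x. frechet_derivative (iterated_deriv v g i) (at x) v)"

lemma k_smooth_iterated_deriv:
  assumes "\<forall>k. k_smooth_on k U g"
  shows "k_smooth_on k U (iterated_deriv v g i)"
  using assms
proof (induction i arbitrary: k)
  case (Suc i)
  then have "k_smooth_on (Suc k) U (iterated_deriv v g i)" by blast
  then show ?case by simp
qed simp

lemma continuous_on_iterated_deriv:
  "\<forall>k. k_smooth_on k U g \<Longrightarrow> continuous_on U (iterated_deriv v g i)"
  using k_smooth_iterated_deriv[of U g 0] by simp

lemma iterated_deriv_along_line: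
  assumes "\<forall>k. k_smooth_on k U g" "x + t *\<^sub>R v \<in> U"
  shows "((\<lambda>s. iterated_deriv v g i (x + s *\<^sub>R v)) has_real_derivative
    iterated_deriv v g (Suc i) (x + t *\<^sub>R v)) (at t)"
proof -
  let ?g = "iterated_deriv v g i"
  have "k_smooth_on (Suc 0) U ?g" by (rule k_smooth_iterated_deriv[OF assms(1)])
  then have "?g differentiable (at (x + t *\<^sub>R v))" using assms(2) by simp
  then have g: "(?g has_derivative frechet_derivative ?g (at (x + t *\<^sub>R v))) (at (x + t *\<^sub>R v))"
    by (simp add: frechet_derivative_works)
  have "((\<lambda>s. x + s *\<^sub>R v) has_derivative (\<lambda>s. s *\<^sub>R v)) (at t)"
    by (auto intro!: derivative_eq_intros)
  from has_derivative_compose[OF this g]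
  have "((\<lambda>s. ?g (x + s *\<^sub>R v)) has_derivative (\<lambda>s. frechet_derivative ?g (at (x + t *\<^sub>R v)) (s *\<^sub>R v))) (at t)" .
  then show ?thesis
    using linear_scale[OF linear_frechet_derivative[OF \<open>?g differentiable _\<close>]]
    by (simp add: has_field_derivative_def mult_commute_abs)
qed

lemma dir_deriv_eq_iterated_deriv:
  assumes g: "\<forall>k. k_smooth_on k U g" and "open U" "x \<in> U"
  shows "dir_deriv i v g x = iterated_deriv v g i x"
proof -
  have "(deriv ^^ i) (\<lambda>s. g (x + s *\<^sub>R v)) t = iterated_deriv v g i (x + t *\<^sub>R v)" if "x + t *\<^sub>R v \<in> U" for t
    using that
  proof (induction i arbitrary: t)
    case (Suc i)
    have "open ((\<lambda>s. x + s *\<^sub>R v) -` U)"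
      by (intro open_vimage \<open>open U\<close> continuous_intros)
    then have "\<forall>\<^sub>F s in nhds t. x + s *\<^sub>R v \<in> U"
      using Suc.prems eventually_nhds_in_open[of "(\<lambda>s. x + s *\<^sub>R v) -` U" t] by simp
    then have "\<forall>\<^sub>F s in nhds t. (deriv ^^ i) (\<lambda>s. g (x + s *\<^sub>R v)) s = iterated_deriv v g i (x + s *\<^sub>R v)"
      by eventually_elim (rule Suc.IH)
    then have "deriv ((deriv ^^ i) (\<lambda>s. g (x + s *\<^sub>R v))) t = deriv (\<lambda>s. iterated_deriv v g i (x + s *\<^sub>R v)) t"
      by (rule deriv_cong_ev) simp
    also have "\<dots> = iterated_deriv v g (Suc i) (x + t *\<^sub>R v)"
      by (rule DERIV_imp_deriv[OF iterated_deriv_along_line[OF g Suc.prems]])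
    finally show ?case by simp
  qed simp
  from this[of 0] show ?thesis using assms by (simp add: dir_deriv_def)
qed

text \<open>
  By the mean value theorem the \<open>d\<close>-th difference at \<open>w R\<close> is the value of the \<open>d\<close>-th derivative at some
  \<open>w R + \<xi> v\<close> with \<open>0 \<le> \<xi> \<le> d\<close>. By homogeneity this is its value at \<open>(w R + \<xi> v) / R\<close>, and this point
  tends to the same limit \<open>y\<close> as \<open>w R / R\<close>. Interior points are used to keep the whole segment in the cone.
\<close>

lemma (in lattice_window) angular_limit_forward_diff:
  assumes g: "\<forall>k. k_smooth_on k U g" and U: "open U" "C \<subseteq> U" and X: "interior X \<subseteq> C"
    and cone: "\<And>x s. x \<in> C \<Longrightarrow> s > 0 \<Longrightarrow> s *\<^sub>R x \<in> C"
    and hom: "\<And>x s. x \<in> C \<Longrightarrow> s > 0 \<Longrightarrow> iterated_deriv v g d (s *\<^sub>R x) = iterated_deriv v g d x"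
  shows "angular_limit ((forward_diff v ^^ d) g) (iterated_deriv v g d)"
  unfolding angular_limit_def
proof (intro ballI allI impI tendstoI)
  let ?h = "iterated_deriv v g d"
  fix y w and e :: real
  assume y: "y \<in> interior X" and w: "((\<lambda>R. w R /\<^sub>R R) \<longlongrightarrow> y) at_top" and e: "e > 0"
  have "isCont ?h y"
    using continuous_on_iterated_deriv[OF g] U X y by (auto simp: continuous_on_eq_continuous_at)
  then obtain \<delta>1 where \<delta>1: "\<delta>1 > 0" "\<And>z. dist z y < \<delta>1 \<Longrightarrow> dist (?h z) (?h y) < e"
    using e by (auto simp: continuous_at_eps_delta)
  obtain \<delta>2 where \<delta>2: "\<delta>2 > 0" "ball y \<delta>2 \<subseteq> interior X"
    using y open_contains_ball[of "interior X"] by auto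
  define \<delta> where "\<delta> = min \<delta>1 \<delta>2"
  have \<delta>: "\<delta> > 0" "\<And>z. dist z y < \<delta> \<Longrightarrow> dist (?h z) (?h y) < e \<and> z \<in> C"
    using \<delta>1 \<delta>2 X by (auto simp: \<delta>_def subset_eq dist_commute)
  have ev_w: "\<forall>\<^sub>F R in at_top. dist (w R /\<^sub>R R) y < \<delta> / 2"
    using tendstoD[OF w, of "\<delta> / 2"] \<delta>(1) by simp
  show "\<forall>\<^sub>F R in at_top. dist ((forward_diff v ^^ d) g (w R)) (?h y) < e"
    using ev_w eventually_gt_at_top[of 0] eventually_gt_at_top[of "2 * (real d * norm v) / \<delta>"]
  proof eventually_elim
    case (elim R)
    have near: "dist ((w R + t *\<^sub>R v) /\<^sub>R R) y < \<delta>" if t: "0 \<le> t" "t \<le> real d" for t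
    proof -
      have "norm (t *\<^sub>R v) \<le> real d * norm v" using t by (simp add: mult_right_mono)
      also have "\<dots> < R * (\<delta> / 2)" using elim(3) \<delta>(1) by (simp add: field_simps)
      finally have "norm ((t *\<^sub>R v) /\<^sub>R R) < \<delta> / 2" using elim(2) by (simp add: field_simps)
      then show ?thesis
        using elim(1) norm_triangle_lt[of "w R /\<^sub>R R - y" "(t *\<^sub>R v) /\<^sub>R R" \<delta>]
        by (simp add: dist_norm scaleR_add_right algebra_simps)
    qed
    have in_C: "w R + t *\<^sub>R v \<in> C" and h_eq: "?h (w R + t *\<^sub>R v) = ?h ((w R + t *\<^sub>R v) /\<^sub>R R)"
      if t: "0 \<le> t" "t \<le> real d" for t
      using \<delta>(2)[OF near[OF t]] cone[of "(w R + t *\<^sub>R v) /\<^sub>R R" R] hom[of "(w R + t *\<^sub>R v) /\<^sub>R R" R] elim(2) by auto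
    have "\<exists>\<xi>. 0 \<le> \<xi> \<and> \<xi> \<le> real d \<and> (forward_diff 1 ^^ d) (\<lambda>t. iterated_deriv v g 0 (w R + t *\<^sub>R v)) 0 = ?h (w R + \<xi> *\<^sub>R v)"
      by (rule forward_diff_mean_value[of d "\<lambda>i t. iterated_deriv v g i (w R + t *\<^sub>R v)"])
        (use in_C U(2) in \<open>blast intro: iterated_deriv_along_line[OF g]\<close>)
    then obtain \<xi> where \<xi>: "0 \<le> \<xi>" "\<xi> \<le> real d" "(forward_diff v ^^ d) g (w R) = ?h (w R + \<xi> *\<^sub>R v)"
      by (auto simp: forward_diff_along_line)
    then show ?case using h_eq[OF \<xi>(1,2)] \<delta>(2)[OF near[OF \<xi>(1,2)]] by simp
  qed
qed

lemma forward_diff_iterate_cmult: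
  fixes g :: "'a::ab_group_add \<Rightarrow> real"
  shows "(forward_diff v ^^ d) (\<lambda>x. c * g x) = (\<lambda>x. c * (forward_diff v ^^ d) g x)"
  by (induction d) (auto simp: forward_diff_def fun_eq_iff right_diff_distrib)

section \<open>Cones over spherical caps\<close>

text \<open>
  For \<open>c \<ge> 0\<close> the set is contained in the frontier of the convex cone \<open>c * norm x \<le> x \<bullet> w\<close>: moving a point
  of the set in the direction \<open>- w\<close> leaves the cone because \<open>c < 1\<close>. The case \<open>c < 0\<close> follows by replacing
  \<open>w\<close> with \<open>- w\<close>.
\<close>

lemma negligible_circular_cone:
  fixes w :: "real^'n"
  assumes "norm w = 1" "\<bar>c\<bar> < 1"
  shows "negligible {x. x \<bullet> w = c * norm x}"
proof -
  have *: "negligible {x. x \<bullet> w = c * norm x}" if w: "norm w = 1" and c: "0 \<le> c" "c < 1" for w :: "real^'n" and c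
  proof -
    define K where "K = {x. c * norm x \<le> x \<bullet> w}"
    have "convex K"
      unfolding K_def
    proof (rule convexI, clarify)
      fix x y and s t :: real
      assume xy: "c * norm x \<le> x \<bullet> w" "c * norm y \<le> y \<bullet> w" and st: "0 \<le> s" "0 \<le> t"
      have "c * norm (s *\<^sub>R x + t *\<^sub>R y) \<le> c * (s * norm x + t * norm y)"
        using norm_triangle_ineq[of "s *\<^sub>R x" "t *\<^sub>R y"] st c by (intro mult_left_mono) auto
      also have "\<dots> = s * (c * norm x) + t * (c * norm y)" by (simp add: algebra_simps)
      also have "\<dots> \<le> s * (x \<bullet> w) + t * (y \<bullet> w)"
        using xy st by (intro add_mono mult_left_mono)
      finally show "c * norm (s *\<^sub>R x + t *\<^sub>R y) \<le> (s *\<^sub>R x + t *\<^sub>R y) \<bullet> w"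
        by (simp add: inner_add_left)
    qed
    have "{x. x \<bullet> w = c * norm x} \<subseteq> frontier K"
    proof
      fix x assume x: "x \<in> {x. x \<bullet> w = c * norm x}"
      then have "x \<in> closure K" using closure_subset[of K] by (auto simp: K_def)
      moreover have "x \<in> closure (- K)"
        unfolding closure_approachable
      proof (intro allI impI)
        fix e :: real assume e: "e > 0"
        have "w \<bullet> w = 1" using w by (simp add: dot_square_norm)
        then have "(x - (e / 2) *\<^sub>R w) \<bullet> w = c * norm x - e / 2" using x by (simp add: inner_diff_left)
        also have "\<dots> < c * norm x - c * (e / 2)" using e c by simp
        also have "\<dots> \<le> c * norm (x - (e / 2) *\<^sub>R w)"
          using mult_left_mono[OF norm_triangle_ineq2[of x "(e / 2) *\<^sub>R w"] c(1)] w e by (simp add: right_diff_distrib)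
        finally show "\<exists>z\<in>- K. dist z x < e"
          using e w by (intro bexI[of _ "x - (e / 2) *\<^sub>R w"]) (auto simp: K_def dist_norm)
      qed
      ultimately show "x \<in> frontier K" by (simp add: frontier_closures)
    qed
    then show ?thesis using negligible_convex_frontier[OF \<open>convex K\<close>] negligible_subset by blast
  qed
  show ?thesis
  proof (cases "c \<ge> 0")
    case False
    then have "negligible {x. x \<bullet> (- w) = (- c) * norm x}" using assms by (intro *) auto
    then show ?thesis by simp
  qed (use * assms in auto)
qed

lemma spherical_cap_subset: "spherical_cap S \<Longrightarrow> S \<subseteq> sphere 0 1"
  by (auto simp: spherical_cap_def)

lemma cone_over_eq:
  assumes "S \<subseteq> sphere 0 1"
  shows "cone_over S = {x. x \<noteq> 0 \<and> x /\<^sub>R norm x \<in> S}"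
proof (intro set_eqI iffI)
  fix x assume "x \<in> {x. x \<noteq> 0 \<and> x /\<^sub>R norm x \<in> S}"
  then show "x \<in> cone_over S"
    unfolding cone_over_def by (auto intro!: exI[of _ "norm x"] exI[of _ "x /\<^sub>R norm x"])
qed (use assms in \<open>auto simp: cone_over_def\<close>)

lemma cone_over_scaleR:
  assumes "x \<in> cone_over S" "s > 0" shows "s *\<^sub>R x \<in> cone_over S"
proof -
  obtain t a where "x = t *\<^sub>R a" "t > 0" "a \<in> S" using assms(1) by (auto simp: cone_over_def)
  then show ?thesis
    unfolding cone_over_def using assms(2) by (auto intro!: exI[of _ "s * t"] exI[of _ a])
qed

lemma negligible_frontier_cone_over:
  assumes "spherical_cap S"
  shows "negligible (frontier (cone_over S))"
proof -
  note eq = cone_over_eq[OF spherical_cap_subset[OF assms]]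
  consider "S = sphere 0 1" | w c where "norm w = 1" "-1 < c" "c < 1"
    "{x \<in> sphere 0 1. x \<bullet> w > c} \<subseteq> S" "S \<subseteq> {x \<in> sphere 0 1. x \<bullet> w \<ge> c}"
    using assms unfolding spherical_cap_def by fastforce
  then show ?thesis
  proof cases
    case 1
    then have "cone_over S = - {0}" unfolding eq by auto
    then show ?thesis by (simp add: frontier_closures negligible_subset[of "{0}"])
  next
    case (2 w c)
    have "cone_over S \<subseteq> {x. c * norm x \<le> x \<bullet> w}"
      unfolding eq using 2(5) by (auto simp: subset_eq inner_scaleR_left divide_simps mult.commute)
    moreover have "closed {x. c * norm x \<le> x \<bullet> w}" by (intro closed_Collect_le continuous_intros)
    ultimately have 1: "closure (cone_over S) \<subseteq> {x. c * norm x \<le> x \<bullet> w}" by (rule closure_minimal)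
    have "- cone_over S \<subseteq> {x. x \<bullet> w \<le> c * norm x}"
    proof
      fix x assume x: "x \<in> - cone_over S"
      show "x \<in> {x. x \<bullet> w \<le> c * norm x}"
      proof (rule ccontr)
        assume *: "x \<notin> {x. x \<bullet> w \<le> c * norm x}"
        then have "x \<noteq> 0" by auto
        with * have "x /\<^sub>R norm x \<in> {x \<in> sphere 0 1. x \<bullet> w > c}" by (auto simp: field_simps)
        then have "x /\<^sub>R norm x \<in> S" using 2(4) by blast
        then show False using x \<open>x \<noteq> 0\<close> by (simp add: eq)
      qed
    qed
    moreover have "closed {x. x \<bullet> w \<le> c * norm x}" by (intro closed_Collect_le continuous_intros)
    ultimately have 2: "closure (- cone_over S) \<subseteq> {x. x \<bullet> w \<le> c * norm x}" by (rule closure_minimal)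
    have "frontier (cone_over S) \<subseteq> {x. x \<bullet> w = c * norm x}"
      unfolding frontier_closures using 1 2 by force
    then show ?thesis
      using negligible_circular_cone[of w c] \<open>norm w = 1\<close> \<open>-1 < c\<close> \<open>c < 1\<close> negligible_subset by (metis abs_less_iff minus_less_iff)
  qed
qed

section \<open>Weyl's criterion on the circle\<close>

lemma sphere_eq_range_mod1: "sphere 0 1 = range mod1"
proof
  show "sphere 0 1 \<subseteq> range mod1"
  proof
    fix z :: complex assume "z \<in> sphere 0 1"
    then have "z = cis (Arg z)" using cis_Arg[of z] by (cases "z = 0") (auto simp: sgn_div_norm)
    then have "z = mod1 (Arg z / (2 * pi))" by (simp add: mod1_def)
    then show "z \<in> range mod1" by blast
  qed
qed auto

lemma haar_circle_facts:
  "prob_space haar_circle" "sets haar_circle = sets sphere_borel" "space haar_circle = sphere 0 1"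
  using invariant_prob_haar_circle by (auto simp: invariant_prob_def dest: sets_eq_imp_space_eq)

lemma rotation_measurable: "norm z = 1 \<Longrightarrow> (\<lambda>w. z * w) \<in> measurable sphere_borel (sphere_borel :: complex measure)"
  unfolding sphere_borel_def
  by (rule measurable_restrict_space3) (auto simp: norm_mult intro!: borel_measurable_continuous_onI continuous_intros)

lemma haar_circle_rotation: "norm z = 1 \<Longrightarrow> distr haar_circle sphere_borel (\<lambda>w. z * w) = haar_circle"
  using invariant_prob_haar_circle by (auto simp: invariant_prob_def)

lemma continuous_on_sphere_measurable:
  "continuous_on (sphere 0 1) f \<Longrightarrow> f \<in> borel_measurable (sphere_borel :: 'a::euclidean_space measure)"
  unfolding sphere_borel_def by (rule borel_measurable_continuous_on_restrict)

lemma singleton_sphere_borel: "z \<in> sphere 0 1 \<Longrightarrow> {z} \<in> sets sphere_borel"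
  by (auto simp: sphere_borel_def sets_restrict_space)

text \<open>
  All singletons of the circle have the same mass, and a finite measure has only countably many atoms.
\<close>

lemma emeasure_haar_circle_singleton:
  assumes "z \<in> sphere 0 1"
  shows "emeasure haar_circle {z} = 0"
proof (rule ccontr)
  interpret prob_space haar_circle by (rule haar_circle_facts)
  assume pos: "emeasure haar_circle {z} \<noteq> 0"
  have "emeasure haar_circle {w * z} = emeasure haar_circle {z}" if w: "norm w = 1" for w
  proof -
    have "w \<noteq> 0" using w by auto
    have "emeasure haar_circle {w * z} = emeasure (distr haar_circle sphere_borel (\<lambda>u. w * u)) {w * z}"
      by (simp add: haar_circle_rotation[OF w])
    also have "\<dots> = emeasure haar_circle ((\<lambda>u. w * u) -` {w * z} \<inter> space haar_circle)"
      using rotation_measurable[OF w] assms w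
      by (intro emeasure_distr singleton_sphere_borel) (auto simp: norm_mult haar_circle_facts cong: measurable_cong_sets)
    also have "(\<lambda>u. w * u) -` {w * z} \<inter> space haar_circle = {z}"
      using \<open>w \<noteq> 0\<close> assms by (auto simp: haar_circle_facts)
    finally show ?thesis .
  qed
  then have "(\<lambda>t. mod1 t * z) ` {0..<1} \<subseteq> {x. measure haar_circle {x} \<noteq> 0}"
    using pos by (auto simp: emeasure_eq_measure)
  then have "countable ((\<lambda>t. mod1 t * z) ` {0..<1})"
    using countable_support countable_subset by blast
  moreover have "inj_on (\<lambda>t. mod1 t * z) {0..<1}"
  proof (rule inj_onI)
    fix s t :: real assume st: "s \<in> {0..<1}" "t \<in> {0..<1}" "mod1 s * z = mod1 t * z"
    moreover have "z \<noteq> 0" using assms by auto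
    ultimately have "s - t \<in> \<int>" by (simp add: mod1_eq_iff)
    then obtain k where "s - t = of_int k" by (auto simp: Ints_def)
    moreover from this st have "k = 0" by auto
    ultimately show "s = t" by simp
  qed
  ultimately have "countable {0..<1::real}" by (rule countable_image_inj_on)
  then show False using uncountable_half_open_interval_1[of 0 "1::real"] by simp
qed

text \<open>
  Real parts of trigonometric polynomials. The conjugate \<open>cnj z\<close>, equal to the inverse of \<open>z\<close> on the circle,
  makes the class closed under products as functions on the whole plane.
\<close>

inductive_set circle_polys :: "(complex \<Rightarrow> real) set" where
  circle_polys_base: "(\<lambda>z. Re (c * z ^ k * cnj z ^ l)) \<in> circle_polys"
| circle_polys_add: "p \<in> circle_polys \<Longrightarrow> q \<in> circle_polys \<Longrightarrow> (\<lambda>z. p z + q z) \<in> circle_polys"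

lemma circle_polys_continuous: "p \<in> circle_polys \<Longrightarrow> continuous_on A p"
  by (induction rule: circle_polys.induct) (auto intro!: continuous_intros)

lemma Re_mult_Re: "Re a * Re b = Re (a * b / 2) + Re (a * cnj b / 2)"
  by (simp add: field_simps)

lemma circle_polys_mult:
  assumes "p \<in> circle_polys" "q \<in> circle_polys"
  shows "(\<lambda>z. p z * q z) \<in> circle_polys"
  using assms(1)
proof induction
  case (circle_polys_base c k l)
  show ?case using assms(2)
  proof induction
    case (circle_polys_base c' k' l')
    have eq: "(\<lambda>z. Re (c * z ^ k * cnj z ^ l) * Re (c' * z ^ k' * cnj z ^ l')) =
      (\<lambda>z. Re ((c * c' / 2) * z ^ (k + k') * cnj z ^ (l + l')) + Re ((c * cnj c' / 2) * z ^ (k + l') * cnj z ^ (l + k')))"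
      unfolding Re_mult_Re by (simp add: power_add mult_ac)
    show ?case unfolding eq by (intro circle_polys.intros)
  next
    case (circle_polys_add p q)
    then show ?case using circle_polys.circle_polys_add by (fastforce simp: distrib_left)
  qed
next
  case (circle_polys_add p1 p2)
  then show ?case using circle_polys.circle_polys_add by (fastforce simp: distrib_right)
qed

lemma function_ring_on_circle_polys: "function_ring_on circle_polys (sphere 0 1)"
proof
  show "(\<lambda>_. c) \<in> circle_polys" for c :: real
    using circle_polys_base[of "of_real c" 0 0] by simp
  fix x y :: complex assume "x \<noteq> y"
  moreover have "(\<lambda>z. Re z) \<in> circle_polys" using circle_polys_base[of 1 1 0] by simp
  moreover have "(\<lambda>z. Im z) \<in> circle_polys" using circle_polys_base[of "- \<i>" 1 0] by simp
  ultimately show "\<exists>f\<in>circle_polys. f x \<noteq> f y" by (auto simp: complex_eq_iff)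
qed (auto intro: circle_polys_continuous circle_polys_add circle_polys_mult)

lemma mod1_power_cnj_power: "mod1 t ^ k * cnj (mod1 t) ^ l = mod1 (of_int (int k - int l) * t)"
  by (simp add: cnj_mod1 mod1_of_nat_mult[symmetric] mod1_add[symmetric] left_diff_distrib)

text \<open>
  The rotation by the angle \<open>\<pi> / (k - l)\<close> preserves the measure and changes the sign of the integrand.
\<close>

lemma integral_haar_circle_monomial:
  assumes "k \<noteq> l"
  shows "integral\<^sup>L haar_circle (\<lambda>z. Re (c * z ^ k * cnj z ^ l)) = 0"
proof -
  let ?p = "\<lambda>z. Re (c * z ^ k * cnj z ^ l)"
  define m where "m = int k - int l"
  have m: "m \<noteq> 0" using assms by (simp add: m_def)
  define w where "w = mod1 (1 / (2 * of_int m))"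
  have w: "norm w = 1" by (simp add: w_def)
  have "w ^ k * cnj w ^ l = mod1 (1 / 2)"
    unfolding w_def mod1_power_cnj_power m_def[symmetric] using m by simp
  then have rot: "w ^ k * cnj w ^ l = -1" by (simp add: mod1_def)
  have p_rot: "?p (w * z) = - ?p z" for z
  proof -
    have "c * (w * z) ^ k * cnj (w * z) ^ l = (w ^ k * cnj w ^ l) * (c * z ^ k * cnj z ^ l)"
      by (simp add: power_mult_distrib mult_ac)
    then show ?thesis by (simp add: rot)
  qed
  have "integral\<^sup>L haar_circle ?p = integral\<^sup>L (distr haar_circle sphere_borel (\<lambda>u. w * u)) ?p"
    by (simp add: haar_circle_rotation[OF w])
  also have "\<dots> = (\<integral>u. ?p (w * u) \<partial>haar_circle)"
    using rotation_measurable[OF w]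
    by (intro integral_distr continuous_on_sphere_measurable continuous_intros)
      (simp_all add: haar_circle_facts cong: measurable_cong_sets)
  also have "\<dots> = - integral\<^sup>L haar_circle ?p" unfolding p_rot by (rule Bochner_Integration.integral_minus)
  finally show ?thesis by simp
qed

text \<open>
  The assumption gives convergence for trigonometric polynomials, which are uniformly dense in the continuous
  functions on the circle by the Stone-Weierstrass theorem.
\<close>

lemma Weyl_criterion:
  fixes A :: "real \<Rightarrow> 'a set" and F :: "'a \<Rightarrow> real"
  assumes fin: "\<forall>\<^sub>F R in at_top. finite (A R) \<and> A R \<noteq> {}"
    and mean: "\<And>k::int. k \<noteq> 0 \<Longrightarrow> ((\<lambda>R. (\<Sum>x\<in>A R. mod1 (of_int k * F x)) / of_nat (card (A R))) \<longlongrightarrow> 0) at_top"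
  shows "weak_conv_on (sphere 0 1)
    (\<lambda>R. distr (uniform_count_measure (A R)) sphere_borel (\<lambda>x. mod1 (F x))) haar_circle at_top"
  unfolding weak_conv_on_def
proof (intro allI impI, elim conjE)
  interpret H: prob_space haar_circle by (rule haar_circle_facts)
  interpret R: function_ring_on circle_polys "sphere (0::complex) 1" by (rule function_ring_on_circle_polys)
  define avg where "avg = (\<lambda>(p :: complex \<Rightarrow> real) R. (\<Sum>x\<in>A R. p (mod1 (F x))) / real (card (A R)))"
  have integrable: "integrable haar_circle p" if "continuous_on (sphere 0 1) p" for p :: "complex \<Rightarrow> real"
  proof -
    have "bounded (p ` sphere 0 1)"
      by (intro compact_imp_bounded compact_continuous_image that compact_sphere)
    then obtain B where "\<And>z. z \<in> sphere 0 1 \<Longrightarrow> norm (p z) \<le> B" by (metis bounded_iff imageI)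
    moreover have "p \<in> borel_measurable haar_circle"
      using continuous_on_sphere_measurable[OF that] by (simp add: haar_circle_facts cong: measurable_cong_sets)
    ultimately show ?thesis by (intro H.integrable_const_bound[of _ B]) (auto simp: haar_circle_facts)
  qed
  have poly: "(avg p \<longlongrightarrow> integral\<^sup>L haar_circle p) at_top" if "p \<in> circle_polys" for p
    using that
  proof induction
    case (circle_polys_base c k l)
    let ?p = "\<lambda>z. Re (c * z ^ k * cnj z ^ l)"
    have p_mod1: "?p (mod1 t) = Re (c * mod1 (of_int (int k - int l) * t))" for t
      by (simp only: mult.assoc mod1_power_cnj_power)
    show ?case
    proof (cases "k = l")
      case True
      have const: "?p (mod1 t) = Re c" for t unfolding p_mod1 using True by (simp add: mod1_def)
      have "integral\<^sup>L haar_circle ?p = integral\<^sup>L haar_circle (\<lambda>_. Re c)"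
        using const by (intro Bochner_Integration.integral_cong) (auto simp: haar_circle_facts sphere_eq_range_mod1)
      moreover have "\<forall>\<^sub>F R in at_top. avg ?p R = Re c"
        using fin by eventually_elim (simp only: avg_def const, simp)
      ultimately show ?thesis by (simp add: H.prob_space tendsto_eventually)
    next
      case False
      have avg_eq: "avg ?p = (\<lambda>R. Re (c * ((\<Sum>x\<in>A R. mod1 (of_int (int k - int l) * F x)) / of_nat (card (A R)))))"
      proof
        fix R
        have "Re (c * ((\<Sum>x\<in>A R. mod1 (of_int (int k - int l) * F x)) / of_nat (card (A R)))) =
            Re ((\<Sum>x\<in>A R. c * mod1 (of_int (int k - int l) * F x)) / of_real (real (card (A R))))"
          by (simp add: sum_distrib_left)
        also have "\<dots> = (\<Sum>x\<in>A R. Re (c * mod1 (of_int (int k - int l) * F x))) / real (card (A R))"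
          unfolding Re_divide_of_real Re_sum ..
        finally show "avg ?p R = Re (c * ((\<Sum>x\<in>A R. mod1 (of_int (int k - int l) * F x)) / of_nat (card (A R))))"
          by (simp only: avg_def p_mod1)
      qed
      have "((\<lambda>R. Re (c * ((\<Sum>x\<in>A R. mod1 (of_int (int k - int l) * F x)) / of_nat (card (A R))))) \<longlongrightarrow> Re (c * 0)) at_top"
        using False by (intro tendsto_Re tendsto_mult tendsto_const mean) simp
      then show ?thesis unfolding avg_eq integral_haar_circle_monomial[OF False] by (simp only: mult_zero_right zero_complex.sel)
    qed
  next
    case (circle_polys_add p q)
    have "avg (\<lambda>z. p z + q z) R = avg p R + avg q R" for R
      by (simp add: avg_def sum.distrib add_divide_distrib)
    then show ?case
      using tendsto_add[OF circle_polys_add.IH] circle_polys_add.hyps integrable[OF circle_polys_continuous] by simp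
  qed
  fix \<phi> :: "complex \<Rightarrow> real"
  assume \<phi>: "continuous_on (sphere 0 1) \<phi>"
  have "(avg \<phi> \<longlongrightarrow> integral\<^sup>L haar_circle \<phi>) at_top"
  proof (rule tendstoI)
    fix e :: real assume e: "e > 0"
    obtain p where p: "p \<in> circle_polys" and close: "\<And>z. z \<in> sphere 0 1 \<Longrightarrow> \<bar>\<phi> z - p z\<bar> < e / 3"
      using R.Stone_Weierstrass_basic[OF \<phi>, of "e / 3"] e by auto
    have int_p: "integrable haar_circle p" using p by (intro integrable circle_polys_continuous)
    have "\<bar>integral\<^sup>L haar_circle \<phi> - integral\<^sup>L haar_circle p\<bar> \<le> (\<integral>z. \<bar>\<phi> z - p z\<bar> \<partial>haar_circle)"
      using integral_abs_bound[of haar_circle "\<lambda>z. \<phi> z - p z"] integrable[OF \<phi>] int_p by simp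
    also have "\<dots> \<le> (\<integral>z. e / 3 \<partial>haar_circle)"
      using close integrable[OF \<phi>] int_p
      by (intro integral_mono) (auto simp: haar_circle_facts intro: less_imp_le)
    finally have int_close: "\<bar>integral\<^sup>L haar_circle \<phi> - integral\<^sup>L haar_circle p\<bar> \<le> e / 3"
      by (simp add: H.prob_space)
    have ev: "\<forall>\<^sub>F R in at_top. dist (avg p R) (integral\<^sup>L haar_circle p) < e / 3"
      using tendstoD[OF poly[OF p], of "e / 3"] e by simp
    show "\<forall>\<^sub>F R in at_top. dist (avg \<phi> R) (integral\<^sup>L haar_circle \<phi>) < e"
      using fin ev
    proof eventually_elim
      case (elim R)
      have card: "real (card (A R)) > 0" using elim(1) by (simp add: card_gt_0_iff)
      have "\<bar>avg \<phi> R - avg p R\<bar> = \<bar>\<Sum>x\<in>A R. \<phi> (mod1 (F x)) - p (mod1 (F x))\<bar> / real (card (A R))"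
        by (simp add: avg_def sum_subtractf flip: diff_divide_distrib)
      also have "\<bar>\<Sum>x\<in>A R. \<phi> (mod1 (F x)) - p (mod1 (F x))\<bar> \<le> (\<Sum>x\<in>A R. e / 3)"
        by (rule order_trans[OF sum_abs sum_mono]) (use close in \<open>auto intro: less_imp_le\<close>)
      also have "(\<Sum>x\<in>A R. e / 3) / real (card (A R)) = e / 3" using card by simp
      finally have "\<bar>avg \<phi> R - avg p R\<bar> \<le> e / 3" using card by (simp add: divide_right_mono)
      then show ?case using int_close elim(2) unfolding dist_real_def by linarith
    qed
  qed
  moreover have "\<forall>\<^sub>F R in at_top. avg \<phi> R =
      integral\<^sup>L (distr (uniform_count_measure (A R)) sphere_borel (\<lambda>x. mod1 (F x))) \<phi>"
    using fin
  proof eventually_elim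
    case (elim R)
    have "(\<lambda>x. mod1 (F x)) \<in> measurable (uniform_count_measure (A R)) sphere_borel"
      by (simp add: uniform_count_measure_def point_measure_def)
    then have "integral\<^sup>L (distr (uniform_count_measure (A R)) sphere_borel (\<lambda>x. mod1 (F x))) \<phi> =
        (\<integral>x. \<phi> (mod1 (F x)) \<partial>uniform_count_measure (A R))"
      by (intro integral_distr continuous_on_sphere_measurable \<phi>)
    also have "\<dots> = avg \<phi> R"
      using elim by (simp add: avg_def integral_uniform_count_measure)
    finally show ?case by simp
  qed
  ultimately show "((\<lambda>R. integral\<^sup>L (distr (uniform_count_measure (A R)) sphere_borel (\<lambda>x. mod1 (F x))) \<phi>) \<longlongrightarrow>
      integral\<^sup>L haar_circle \<phi>) at_top"
    by (simp add: tendsto_cong)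
qed

section \<open>Irrational values almost everywhere\<close>

text \<open>
  The radial projection commutes with orthogonal maps, which preserve the uniform measure on the ball. So its
  image is invariant, and there is only one invariant probability measure. The unit vector \<open>e\<close> is an arbitrary
  value at the origin, where the projection is undefined.
\<close>

lemma sphere_prob_eq_radial_projection:
  fixes e :: "real^'n"
  assumes e: "norm e = 1"
  shows "sphere_prob = distr (uniform_measure lborel (ball 0 1)) sphere_borel (\<lambda>x. if x = 0 then e else x /\<^sub>R norm x)"
    (is "_ = distr ?U sphere_borel ?p")
proof (rule invariant_prob_orthogonal_unique[OF invariant_prob_sphere_prob])
  have p: "?p \<in> measurable ?U sphere_borel"
    unfolding sphere_borel_def by (rule measurable_restrict_space2) (auto simp: e)
  have U: "prob_space ?U"
    using open_not_negligible[of "ball (0 :: real^'n) 1"] emeasure_lborel_ball_finite[of "0 :: real^'n" 1]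
    by (intro prob_space_uniform_measure) (auto simp: negligible_iff_null_sets null_sets_def)
  have "distr (distr ?U sphere_borel ?p) sphere_borel T = distr ?U sphere_borel ?p"
    if T: "orthogonal_transformation T" for T
  proof -
    have T_borel[measurable]: "T \<in> borel_measurable borel" by (rule orthogonal_borel[OF T])
    have commute: "T (?p x) = ?p (T x)" if "x \<noteq> 0" for x
      using T that by (auto simp: orthogonal_transformation linear_scale)
        (metis norm_eq_zero)
    have "AE x in ?U. x \<noteq> 0"
      by (rule AE_uniform_measureI) (use AE_lborel_singleton[of "0 :: real^'n"] in auto)
    then have "AE x in ?U. T (?p x) = ?p (T x)" by eventually_elim (rule commute)
    moreover have pT: "(\<lambda>x. ?p (T x)) \<in> measurable ?U sphere_borel"
      unfolding sphere_borel_def by (rule measurable_restrict_space2) (auto simp: e)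
    ultimately have "distr ?U sphere_borel (\<lambda>x. T (?p x)) = distr ?U sphere_borel (\<lambda>x. ?p (T x))"
      using measurable_compose[OF p orthogonal_sphere_borel[OF T]] by (intro distr_cong_AE) auto
    also have "\<dots> = distr (distr ?U borel T) sphere_borel ?p"
      using distr_distr[of ?p borel sphere_borel T ?U] p by (simp add: comp_def)
    also have "\<dots> = distr ?U sphere_borel ?p"
      by (simp only: uniform_ball_distr_orthogonal[OF T])
    finally show ?thesis
      using distr_distr[OF orthogonal_sphere_borel[OF T] p] by (simp add: comp_def)
  qed
  then show "invariant_prob {T. orthogonal_transformation T} (distr ?U sphere_borel ?p)"
    using prob_space.prob_space_distr[OF U p] by (simp add: invariant_prob_def)
qed

text \<open>
  Inside the unit ball, the cone over \<open>T\<close> and the preimage of \<open>T\<close> under the radial projection differ at most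
  by the origin.
\<close>

lemma sphere_prob_null_iff:
  assumes T: "T \<in> sets (sphere_borel :: (real^'n) measure)"
  shows "emeasure sphere_prob T = 0 \<longleftrightarrow> negligible (cone_over T \<inter> ball 0 1)"
proof -
  obtain e :: "real^'n" where e: "norm e = 1" using vector_choose_size[of 1] by auto
  let ?p = "\<lambda>x::real^'n. if x = 0 then e else x /\<^sub>R norm x"
  have T_sub: "T \<subseteq> sphere 0 1" using sets.sets_into_space[OF T] by simp
  have p: "?p \<in> measurable borel sphere_borel"
    unfolding sphere_borel_def by (rule measurable_restrict_space2) (auto simp: e)
  have B: "?p -` T \<in> sets borel" using measurable_sets[OF p T] by simp
  have B': "ball 0 1 \<inter> ?p -` T \<in> sets borel" using B by simp
  have "emeasure sphere_prob T = emeasure lborel (ball 0 1 \<inter> ?p -` T) / emeasure lborel (ball (0 :: real^'n) 1)"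
    unfolding sphere_prob_eq_radial_projection[OF e] using p T B
    by (simp add: emeasure_distr emeasure_uniform_measure)
  then have "emeasure sphere_prob T = 0 \<longleftrightarrow> emeasure lborel (ball 0 1 \<inter> ?p -` T) = 0"
    using emeasure_lborel_ball_finite[of "0 :: real^'n" 1] by (auto simp: ennreal_divide_eq_0_iff)
  also have "\<dots> \<longleftrightarrow> negligible (ball 0 1 \<inter> ?p -` T)"
    using B' by (auto simp: negligible_iff_null_sets null_sets_def)
  also have "\<dots> \<longleftrightarrow> negligible (cone_over T \<inter> ball 0 1)"
  proof
    have "cone_over T \<inter> ball 0 1 \<subseteq> ball 0 1 \<inter> ?p -` T" by (auto simp: cone_over_eq[OF T_sub])
    then show "negligible (ball 0 1 \<inter> ?p -` T) \<Longrightarrow> negligible (cone_over T \<inter> ball 0 1)"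
      by (rule negligible_subset[rotated])
    have "ball 0 1 \<inter> ?p -` T \<subseteq> (cone_over T \<inter> ball 0 1) \<union> {0}" by (auto simp: cone_over_eq[OF T_sub])
    then show "negligible (cone_over T \<inter> ball 0 1) \<Longrightarrow> negligible (ball 0 1 \<inter> ?p -` T)"
      by (meson negligible_Un negligible_sing negligible_subset)
  qed
  finally show ?thesis .
qed

lemma mod1_in_image_Rats: "mod1 t \<in> mod1 ` \<rat> \<longleftrightarrow> t \<in> \<rat>"
proof
  assume "mod1 t \<in> mod1 ` \<rat>"
  then obtain q where q: "q \<in> \<rat>" "t - q \<in> \<int>" by (auto simp: mod1_eq_iff)
  then have "t - q \<in> \<rat>" using Ints_subset_Rats by blast
  from Rats_add[OF this q(1)] show "t \<in> \<rat>" by simp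
qed simp

text \<open>
  The rational points of the circle form a countable set. It is null for the Haar measure, which has no atoms, and
  it avoids the irrational point on which \<open>\<mu>\<close> is concentrated in the other case.
\<close>

lemma rational_points_null:
  assumes "prob_space \<mu>" "sets \<mu> = sets sphere_borel"
    and "absolutely_continuous haar_circle \<mu> \<or> (\<exists>\<alpha>. \<alpha> \<notin> \<rat> \<and> emeasure \<mu> {mod1 \<alpha>} = 1)"
  shows "mod1 ` \<rat> \<in> null_sets \<mu>"
  using assms(3)
proof (elim disjE exE conjE)
  assume ac: "absolutely_continuous haar_circle \<mu>"
  have "(\<Union>q\<in>\<rat>. {mod1 q}) \<in> null_sets haar_circle"
    by (intro null_sets_UN' countable_rat)
      (auto simp: null_sets_def haar_circle_facts emeasure_haar_circle_singleton singleton_sphere_borel)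
  moreover have "(\<Union>q\<in>\<rat>. {mod1 q}) = mod1 ` \<rat>" by auto
  ultimately show ?thesis using ac by (auto simp: absolutely_continuous_def)
next
  fix \<alpha> assume \<alpha>: "\<alpha> \<notin> \<rat>" "emeasure \<mu> {mod1 \<alpha>} = 1"
  interpret prob_space \<mu> by fact
  have "AE z in \<mu>. z \<in> {mod1 \<alpha>}"
    using \<alpha>(2) singleton_sphere_borel[of "mod1 \<alpha>"] assms(2)
    by (intro AE_prob_1) (auto simp: emeasure_eq_measure)
  moreover have "mod1 \<alpha> \<notin> mod1 ` \<rat>"
    using \<alpha>(1) by (simp add: mod1_in_image_Rats)
  ultimately have "AE z in \<mu>. z \<notin> mod1 ` \<rat>" by (auto elim: eventually_mono)
  moreover have "mod1 ` \<rat> \<in> sets \<mu>"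
  proof -
    have "(\<Union>q\<in>\<rat>. {mod1 q}) \<in> sets \<mu>"
      by (intro sets.countable_UN' countable_rat) (auto simp: assms(2) singleton_sphere_borel)
    moreover have "(\<Union>q\<in>\<rat>. {mod1 q}) = mod1 ` \<rat>" by auto
    ultimately show ?thesis by simp
  qed
  ultimately show ?thesis by (simp add: AE_iff_null_sets)
qed

lemma spherical_cap_borel:
  assumes "spherical_cap S"
  shows "S \<in> sets sphere_borel"
proof -
  have gt: "sphere 0 1 \<inter> {x. x \<bullet> w > c} \<in> sets (sphere_borel :: (real^'n) measure)"
    and ge: "sphere 0 1 \<inter> {x. x \<bullet> w \<ge> c} \<in> sets (sphere_borel :: (real^'n) measure)" for w c
    unfolding sphere_borel_def sets_restrict_space by (rule imageI, measurable)+
  have all: "sphere 0 1 \<in> sets (sphere_borel :: (real^'n) measure)"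
    using sets.top[of sphere_borel] by simp
  show ?thesis
    using assms unfolding spherical_cap_def by (elim disjE exE conjE) (use all gt ge in \<open>simp_all add: Int_def\<close>)
qed

text \<open>
  A cap of measure \<open>0\<close> would make \<open>cap_prob\<close> the zero measure, because \<open>0 / 0 = 0\<close>, and its image could not be
  a probability measure. Once the cap has positive measure, null sets of the image pull back to null sets of the
  invariant measure.
\<close>

lemma cap_prob_pushforward:
  fixes k :: "real^'n \<Rightarrow> real"
  assumes S: "spherical_cap S" and k: "continuous_on S k"
    and \<mu>: "prob_space \<mu>" "distr (cap_prob S) sphere_borel (\<lambda>x. mod1 (k x)) = \<mu>"
  shows "emeasure sphere_prob S \<noteq> 0"
    and "mod1 ` \<rat> \<in> null_sets \<mu> \<Longrightarrow> {x \<in> S. k x \<in> \<rat>} \<in> null_sets sphere_prob"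
proof -
  let ?m = "restrict_space sphere_prob S"
  have S_sub: "S \<subseteq> sphere 0 1" by (rule spherical_cap_subset[OF S])
  have sp: "prob_space (sphere_prob :: (real^'n) measure)" "sets (sphere_prob :: (real^'n) measure) = sets sphere_borel"
    using invariant_prob_sphere_prob by (auto simp: invariant_prob_def)
  then have space_sp: "space (sphere_prob :: (real^'n) measure) = sphere 0 1"
    using sets_eq_imp_space_eq[of "sphere_prob :: (real^'n) measure" sphere_borel] by simp
  have S_sp: "S \<in> sets sphere_prob" using spherical_cap_borel[OF S] sp by simp
  have sets_m: "sets ?m = sets (restrict_space borel S)"
  proof -
    have "S \<inter> (sphere 0 1 \<inter> A) = S \<inter> A" for A using S_sub by blast
    then show ?thesis
      unfolding sets_restrict_space sp(2) sphere_borel_def image_image by (simp only:)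
  qed
  have space_m: "space ?m = S" using S_sub space_sp by (auto simp: space_restrict_space)
  have S_m: "S \<in> sets ?m" using sets.top[of ?m] space_m by simp
  have em: "emeasure ?m A = emeasure sphere_prob A" if "A \<subseteq> S" for A
    using sets.Int_space_eq2[OF S_sp] S_sp that by (intro emeasure_restrict_space) simp_all
  have cap: "emeasure (cap_prob S) A = emeasure sphere_prob A / emeasure sphere_prob S" if "A \<in> sets ?m" for A
    using that sets.sets_into_space[OF that] S_m em space_m
    by (simp add: cap_prob_def emeasure_uniform_measure Int_absorb1)
  have meas: "(\<lambda>x. mod1 (k x)) \<in> measurable (cap_prob S) sphere_borel"
  proof -
    have "(\<lambda>x. mod1 (k x)) \<in> borel_measurable (restrict_space borel S)"
      by (intro borel_measurable_continuous_on_restrict continuous_on_mod1 k)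
    then have "(\<lambda>x. mod1 (k x)) \<in> measurable (restrict_space borel S) sphere_borel"
      unfolding sphere_borel_def by (intro measurable_restrict_space2) auto
    moreover have "sets (cap_prob S) = sets (restrict_space borel S)" by (simp add: cap_prob_def sets_m)
    ultimately show ?thesis by (simp cong: measurable_cong_sets)
  qed
  have space_cap: "space (cap_prob S) = S" by (simp add: cap_prob_def space_m)
  show "emeasure sphere_prob S \<noteq> 0"
  proof
    assume "emeasure sphere_prob S = 0"
    then have "emeasure (cap_prob S) S = 0" using cap[OF S_m] by simp
    moreover have "prob_space (cap_prob S)"
      using prob_space_distrD[OF meas] \<mu> by simp
    ultimately show False using prob_space.emeasure_space_1[of "cap_prob S"] by (simp add: space_cap)
  qed
  assume null: "mod1 ` \<rat> \<in> null_sets \<mu>"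
  then have Q: "mod1 ` \<rat> \<in> sets sphere_borel" using \<mu>(2) by auto
  have pre: "(\<lambda>x. mod1 (k x)) -` (mod1 ` \<rat>) \<inter> space (cap_prob S) = {x \<in> S. k x \<in> \<rat>}"
    by (simp add: set_eq_iff space_cap mod1_in_image_Rats conj_commute)
  have A: "{x \<in> S. k x \<in> \<rat>} \<in> sets ?m"
    using measurable_sets[OF meas Q] unfolding pre by (simp add: cap_prob_def)
  have "0 = emeasure (distr (cap_prob S) sphere_borel (\<lambda>x. mod1 (k x))) (mod1 ` \<rat>)"
    using null by (simp add: \<mu>(2) null_setsD1)
  also have "\<dots> = emeasure sphere_prob {x \<in> S. k x \<in> \<rat>} / emeasure sphere_prob S"
    unfolding emeasure_distr[OF meas Q] pre by (rule cap[OF A])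
  finally have "emeasure sphere_prob {x \<in> S. k x \<in> \<rat>} = 0"
    using prob_space.emeasure_le_1[OF sp(1), of S] by (auto simp: ennreal_divide_eq_0_iff top_unique)
  moreover have "{x \<in> S. k x \<in> \<rat>} \<in> sets sphere_prob"
    using A S_sp sets_restrict_space_iff[of S sphere_prob] sets.Int_space_eq2[OF S_sp] by simp
  ultimately show "{x \<in> S. k x \<in> \<rat>} \<in> null_sets sphere_prob" by (simp add: null_sets_def)
qed

section \<open>Equidistribution\<close>

theorem theorem2p4:
  fixes M :: "real^'n^'n" and S :: "(real^'n) set" and \<mu> :: "complex measure"
    and f :: "real^'n \<Rightarrow> real" and u :: "real^'n"
  assumes "invertible M"
    and "spherical_cap S"
    and "prob_space \<mu>" and "sets \<mu> = sets sphere_borel"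
    and "absolutely_continuous haar_circle \<mu> \<or> (\<exists>\<alpha>. \<alpha> \<notin> \<rat> \<and> emeasure \<mu> {mod1 \<alpha>} = 1)"
    and "smooth_on_cone S f"
    and "MS_related M S f \<mu>"
  shows "equidistributed_mod1 ((\<lambda>x. x + u) ` point_lattice M) (cone_over S) f"
proof -
  define C where "C = cone_over S"
  define X where "X = C \<inter> ball 0 1"
  \<comment> \<open>The extension whose derivatives enter the definition of \<open>cone_deriv\<close>.\<close>
  define g where "g = (SOME g. smooth_extension S f g)"
  have "smooth_extension S f g"
    unfolding g_def using someI_ex[of "smooth_extension S f"] assms(6) by (simp add: smooth_on_cone_def)
  then obtain U where U: "open U" "C \<subseteq> U" and g: "\<forall>k. k_smooth_on k U g" and gf: "\<And>x. x \<in> C \<Longrightarrow> g x = f x"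
    unfolding smooth_extension_def C_def by blast
  obtain d v where d: "d \<ge> 1" and v: "v \<in> point_lattice M"
    and hom: "\<And>x s. x \<in> C \<Longrightarrow> s > 0 \<Longrightarrow> cone_deriv S d v f (s *\<^sub>R x) = cone_deriv S d v f x"
    and push: "distr (cap_prob S) sphere_borel (\<lambda>x. mod1 (cone_deriv S d v f x)) = \<mu>"
    using assms(7) unfolding MS_related_def C_def by blast
  define h where "h = iterated_deriv v g d"
  have deriv_eq: "cone_deriv S d v f x = h x" if "x \<in> C" for x
    using dir_deriv_eq_iterated_deriv[OF g U(1), of x d v] U(2) that
    by (auto simp: cone_deriv_def g_def h_def)
  have C_scale: "s *\<^sub>R x \<in> C" if "x \<in> C" "s > 0" for x s
    using that unfolding C_def by (rule cone_over_scaleR)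
  have h_hom: "h (s *\<^sub>R x) = h x" if "x \<in> C" "s > 0" for x s
    using hom[OF that] deriv_eq C_scale that by simp
  have h_cont: "continuous_on C h"
    unfolding h_def using continuous_on_iterated_deriv[OF g] U(2) continuous_on_subset by blast
  have S_sub: "S \<subseteq> sphere 0 1" by (rule spherical_cap_subset[OF assms(2)])
  have C_eq: "C = {x. x \<noteq> 0 \<and> x /\<^sub>R norm x \<in> S}"
    unfolding C_def by (rule cone_over_eq[OF S_sub])
  have SC: "S \<subseteq> C" unfolding C_eq using S_sub by (auto simp: subset_eq)
  have "frontier X \<subseteq> frontier C \<union> frontier (ball 0 1)"
    unfolding X_def by (rule frontier_Int_subset)
  then have front: "negligible (frontier X)"
    using negligible_frontier_cone_over[OF assms(2)] negligible_convex_frontier[OF convex_ball, of "0 :: real^'n" 1]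
    unfolding C_def by (meson negligible_Un negligible_subset)
  interpret lattice_window M u X
    using assms(1) front by unfold_locales (auto simp: X_def)

  have k_cont: "continuous_on S (cone_deriv S d v f)"
    by (rule continuous_on_eq[OF continuous_on_subset[OF h_cont SC]]) (use deriv_eq SC in auto)
  note push_facts = cap_prob_pushforward[OF assms(2) k_cont assms(3) push]
  \<comment> \<open>A window without interior would be contained in its negligible frontier, but the cap has positive measure.\<close>
  have int_ne: "interior X \<noteq> {}"
  proof
    assume "interior X = {}"
    then have "X \<subseteq> frontier X" using closure_subset by (auto simp: frontier_def)
    then have "negligible X" using front negligible_subset by blast
    then show False
      using push_facts(1) sphere_prob_null_iff[OF spherical_cap_borel[OF assms(2)]] by (simp add: X_def C_def)
  qed
  define T where "T = {x \<in> S. cone_deriv S d v f x \<in> \<rat>}"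
  have "T \<in> null_sets sphere_prob"
    unfolding T_def by (rule push_facts(2)[OF rational_points_null[OF assms(3-5)]])
  then have "negligible (cone_over T \<inter> ball 0 1)"
    using invariant_prob_sphere_prob[where 'n='n] sphere_prob_null_iff[of T]
    by (auto simp: null_sets_def invariant_prob_def)
  \<comment> \<open>By homogeneity, \<open>h\<close> takes the same value at \<open>x\<close> as at its projection to the sphere.\<close>
  moreover have "{x \<in> X. h x \<in> \<rat>} \<subseteq> cone_over T \<inter> ball 0 1"
  proof
    fix x assume x: "x \<in> {x \<in> X. h x \<in> \<rat>}"
    then have xC: "x \<in> C" by (simp add: X_def)
    then have "x \<noteq> 0" "x /\<^sub>R norm x \<in> S" by (auto simp: C_eq)
    moreover from this have "h (x /\<^sub>R norm x) = h x" using xC by (intro h_hom) auto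
    ultimately have "x /\<^sub>R norm x \<in> T" using x SC deriv_eq by (auto simp: T_def)
    moreover have "T \<subseteq> sphere 0 1" using S_sub by (auto simp: T_def)
    ultimately show "x \<in> cone_over T \<inter> ball 0 1"
      using x \<open>x \<noteq> 0\<close> by (auto simp: X_def cone_over_eq)
  qed
  ultimately have "negligible {x \<in> X. h x \<in> \<rat>}" by (rule negligible_subset)
  then have "AE y in lborel. M *v y \<notin> {x \<in> X. h x \<in> \<rat>}" by (rule AE_linear_avoids[OF assms(1)])
  then have irr: "irrational_on_window h"
    unfolding irrational_on_window_def by eventually_elim (use interior_subset in blast)
  have X_int: "interior X \<subseteq> C" using interior_subset by (auto simp: X_def)
  have lim: "angular_limit ((forward_diff v ^^ d) g) h"
    unfolding h_def
    by (rule angular_limit_forward_diff[OF g U X_int C_scale]) (use h_hom in \<open>auto simp: h_def\<close>)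

  have harmonics: "((\<lambda>R. scaled_sum R (\<lambda>x. mod1 (of_int k * g x))) \<longlongrightarrow> 0) at_top" if k: "k \<noteq> 0" for k :: int
  proof -
    have "angular_limit ((forward_diff v ^^ d) (\<lambda>x. of_int k * g x)) (\<lambda>y. of_int k * h y)"
      using lim unfolding forward_diff_iterate_cmult angular_limit_def by (auto intro: tendsto_mult_left)
    moreover obtain d' where "d = Suc d'" using d by (cases d) auto
    ultimately show ?thesis
      using irrational_on_window_mult[OF irr k] continuous_on_subset[OF h_cont X_int]
      by (intro mod1_scaled_sum_tendsto_0[OF v, where h = "\<lambda>y. of_int k * h y" and d = d']) (auto intro: continuous_on_mult_left)
  qed
  have conv: "weak_conv_on (sphere 0 1)
      (\<lambda>R. distr (uniform_count_measure (window R)) sphere_borel (\<lambda>x. mod1 (g x))) haar_circle at_top"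
  proof (rule Weyl_criterion)
    show "\<forall>\<^sub>F R in at_top. finite (window R) \<and> window R \<noteq> {}"
      by (rule window_eventually_nonempty[OF int_ne])
    show "((\<lambda>R. (\<Sum>x\<in>window R. mod1 (of_int k * g x)) / of_nat (card (window R))) \<longlongrightarrow> 0) at_top"
      if "k \<noteq> 0" for k :: int
      by (rule window_mean_tendsto_0[OF int_ne harmonics[OF that]])
  qed
  have same: "distr (uniform_count_measure (window R)) sphere_borel (\<lambda>x. mod1 (g x)) =
      distr (uniform_count_measure ((\<lambda>x. x + u) ` point_lattice M \<inter> ball 0 R \<inter> cone_over S)) sphere_borel (\<lambda>x. mod1 (f x))"
    if R: "R > 0" for R
  proof -
    have in_C: "x /\<^sub>R R \<in> C \<longleftrightarrow> x \<in> C" for x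
    proof
      assume "x /\<^sub>R R \<in> C"
      from C_scale[OF this R] show "x \<in> C" using R by simp
    qed (use C_scale[of x "inverse R"] R in simp)
    have in_ball: "x /\<^sub>R R \<in> ball 0 1 \<longleftrightarrow> x \<in> ball 0 R" for x :: "real^'n"
      using R by (simp add: field_simps)
    have w: "window R = (\<lambda>x. x + u) ` point_lattice M \<inter> ball 0 R \<inter> cone_over S"
    proof (rule set_eqI)
      fix x
      have "x /\<^sub>R R \<in> X \<longleftrightarrow> x \<in> C \<and> x \<in> ball 0 R" unfolding X_def Int_iff in_C in_ball ..
      then show "x \<in> window R \<longleftrightarrow> x \<in> (\<lambda>x. x + u) ` point_lattice M \<inter> ball 0 R \<inter> cone_over S"
        unfolding window_def points_def C_def[symmetric] by blast
    qed
    show ?thesis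
      unfolding w[symmetric]
    proof (rule distr_cong)
      fix x assume "x \<in> space (uniform_count_measure (window R))"
      then have "x \<in> C" by (simp add: w C_def space_uniform_count_measure)
      then show "mod1 (g x) = mod1 (f x)" by (simp add: gf)
    qed simp_all
  qed
  show ?thesis
    unfolding equidistributed_mod1_def weak_conv_on_def
  proof (intro allI impI)
    fix \<phi> :: "complex \<Rightarrow> real"
    assume "continuous_on (sphere 0 1) \<phi> \<and> bounded (\<phi> ` sphere 0 1)"
    with conv have lim_\<phi>: "((\<lambda>R. integral\<^sup>L (distr (uniform_count_measure (window R)) sphere_borel (\<lambda>x. mod1 (g x))) \<phi>)
        \<longlongrightarrow> integral\<^sup>L haar_circle \<phi>) at_top"
      by (simp add: weak_conv_on_def)
    show "((\<lambda>R. integral\<^sup>L (distr (uniform_count_measure ((\<lambda>x. x + u) ` point_lattice M \<inter> ball 0 R \<inter> cone_over S))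
        sphere_borel (\<lambda>x. mod1 (f x))) \<phi>) \<longlongrightarrow> integral\<^sup>L haar_circle \<phi>) at_top"
      by (rule Lim_transform_eventually[OF lim_\<phi>], rule eventually_mono[OF eventually_gt_at_top[of 0]])
        (simp only: same)
  qed
qed

end
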